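(* Let $p$ be a prime and let $R$ be a regular ring of characteristic $p$ such that $R$ is a finitely generated free module over its subring $R^p=\{a^p : a\in R\}$. 1) For every ideal $I$ of $R$, there are $f\in R$ and $c>0$ such that $I=\tau(f^c)$. 2) Moreover, if $\mathfrak m$ is a maximal ideal of $R$ and $I$ is an $\mathfrak m$-primary ideal, then there are an $\mathfrak m$-primary ideal $\mathfrak b$ and $c'>0$ such that $I=\tau(\mathfrak b^{c'})$.
   Context: Rings are commutative with $1$; regular rings are Noetherian. A ring of characteristic $p$ is one containing $\mathbb{F}_p$. The exponents $c,c'$ are real numbers. Generalized test ideals. Let $R$ be a regular ring of prime characteristic $p$ that is a finitely generated free module over $R^p$; then $R$ is finitely generated and free over $R^{p^e}=\{a^{p^e}: a\in R\}$ for every $e\ge 1$. For an ideal $J$ of $R$, $J^{[p^e]}$ denotes the ideal generated by $\{u^{p^e}: u\in J\}$. For an ideal $\mathfrak{b}$ of $R$ and $e\ge 1$, $\mathfrak{b}^{[1/p^e]}$ denotes the unique smallest ideal $J$ (with respect to inclusion) such that $\mathfrak{b}\subseteq J^{[p^e]}$. Explicitly: if $u_1,\dots,u_N$ is a basis of $R$ over $R^{p^e}$, $\mathfrak b=(h_1,\dots,h_s)$, and $h_i=\sum_{j=1}^N a_{ij}^{p^e}u_j$ with $a_{ij}\in R$, then $\mathfrak{b}^{[1/p^e]}=(a_{ij}: 1\le i\le s,\ 1\le j\le N)$. For an ideal $\mathfrak a$ of $R$ and a real number $t\ge 0$, the ideals $(\mathfrak a^{\lceil tp^e\rceil})^{[1/p^e]}$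 form an increasing sequence in $e$, and the generalized test ideal $\tau(\mathfrak a^t)$ is their stable value, i.e. $\tau(\mathfrak a^t)=(\mathfrak a^{\lceil tp^e\rceil})^{[1/p^e]}$ for $e\gg 0$. For $f\in R$ one writes $\tau(f^t)$ for $\tau((f)^t)$. *)

theory Defs
  imports Complex_Main "HOL-Library.Extended_Nat" "HOL-Library.FuncSet"
    "HOL-Computational_Algebra.Primes" "HOL-Algebra.Algebra"
begin

section \<open>Localization\<close>

text \<open>The fraction \<open>r/s\<close> as an equivalence class; \<open>S\<close> is meant to be a multiplicative subset
  of a commutative ring \<open>R\<close>.\<close>

definition loc_frac :: "('a, 'b) ring_scheme \<Rightarrow> 'a set \<Rightarrow> 'a \<Rightarrow> 'a \<Rightarrow> ('a \<times> 'a) set" where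
  "loc_frac R S r s = {(r', s') \<in> carrier R \<times> S.
     \<exists>t\<in>S. t \<otimes>\<^bsub>R\<^esub> (s' \<otimes>\<^bsub>R\<^esub> r) = t \<otimes>\<^bsub>R\<^esub> (s \<otimes>\<^bsub>R\<^esub> r')}"

definition localization :: "('a, 'b) ring_scheme \<Rightarrow> 'a set \<Rightarrow> ('a \<times> 'a) set ring" where
  "localization R S =
    \<lparr>carrier = {loc_frac R S r s | r s. r \<in> carrier R \<and> s \<in> S},
     monoid.mult = (\<lambda>U V. \<Union>(r, s)\<in>U. \<Union>(r', s')\<in>V. loc_frac R S (r \<otimes>\<^bsub>R\<^esub> r') (s \<otimes>\<^bsub>R\<^esub> s')),
     one = loc_frac R S \<one>\<^bsub>R\<^esub> \<one>\<^bsub>R\<^esub>,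
     ring.zero = loc_frac R S \<zero>\<^bsub>R\<^esub> \<one>\<^bsub>R\<^esub>,
     ring.add = (\<lambda>U V. \<Union>(r, s)\<in>U. \<Union>(r', s')\<in>V.
       loc_frac R S (s' \<otimes>\<^bsub>R\<^esub> r \<oplus>\<^bsub>R\<^esub> s \<otimes>\<^bsub>R\<^esub> r') (s \<otimes>\<^bsub>R\<^esub> s'))\<rparr>"

section \<open>Regular rings\<close>

definition krull_dim :: "('a, 'b) ring_scheme \<Rightarrow> enat" where
  "krull_dim R = Sup {enat n | n.
     \<exists>P. (\<forall>i\<le>n. primeideal (P i) R) \<and> (\<forall>i<n. P i \<subset> P (Suc i))}"

locale local_ring = cring +
  assumes unique_maximal: "\<exists>!M. maximalideal M R"

text \<open>A Noetherian local ring is regular if its maximal ideal is generated by \<open>dim R\<close> elements.\<close>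

locale regular_local_ring = local_ring + noetherian_ring +
  assumes regular_generators:
    "\<exists>B \<subseteq> carrier R. finite B \<and> maximalideal (Idl B) R \<and> enat (card B) = krull_dim R"

locale regular_ring = cring + noetherian_ring +
  assumes regular_localization:
    "primeideal P R \<Longrightarrow> regular_local_ring (localization R (carrier R - P))"

section \<open>Characteristic \<open>p\<close> and freeness over Frobenius powers\<close>

definition contains_prime_field :: "('a, 'b) ring_scheme \<Rightarrow> nat \<Rightarrow> bool" where
  "contains_prime_field R p \<longleftrightarrow>
     (\<exists>h \<in> ring_hom (ZFact (int p)) R. inj_on h (carrier (ZFact (int p))))"

definition power_subring :: "('a, 'b) ring_scheme \<Rightarrow> nat \<Rightarrow> 'a set" where
  "power_subring R q = {a [^]\<^bsub>R\<^esub> q | a. a \<in> carrier R}"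

definition finite_free_over :: "('a, 'b) ring_scheme \<Rightarrow> 'a set \<Rightarrow> bool" where
  "finite_free_over R K \<longleftrightarrow>
     (\<exists>B \<subseteq> carrier R. finite B \<and>
       (\<forall>x \<in> carrier R. \<exists>!c. c \<in> B \<rightarrow>\<^sub>E K \<and> x = (\<Oplus>\<^bsub>R\<^esub>b\<in>B. c b \<otimes>\<^bsub>R\<^esub> b)))"

section \<open>Primary ideals\<close>

definition ideal_radical :: "('a, 'b) ring_scheme \<Rightarrow> 'a set \<Rightarrow> 'a set" where
  "ideal_radical R I = {x \<in> carrier R. \<exists>n::nat. x [^]\<^bsub>R\<^esub> n \<in> I}"

definition primary_ideal :: "('a, 'b) ring_scheme \<Rightarrow> 'a set \<Rightarrow> bool" where
  "primary_ideal R I \<longleftrightarrow> ideal I R \<and> I \<noteq> carrier R \<and>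
     (\<forall>x \<in> carrier R. \<forall>y \<in> carrier R.
        x \<otimes>\<^bsub>R\<^esub> y \<in> I \<longrightarrow> x \<in> I \<or> (\<exists>n::nat. y [^]\<^bsub>R\<^esub> n \<in> I))"

definition primary_to :: "('a, 'b) ring_scheme \<Rightarrow> 'a set \<Rightarrow> 'a set \<Rightarrow> bool" where
  "primary_to R M I \<longleftrightarrow> primary_ideal R I \<and> ideal_radical R I = M"

section \<open>Generalized test ideals\<close>

text \<open>\<open>frob_power R J q\<close> is the ideal usually written \<open>J\<^sup>[\<^sup>q\<^sup>]\<close> and \<open>frob_root R \<bb> q\<close> is
  \<open>\<bb>\<^sup>[\<^sup>1\<^sup>/\<^sup>q\<^sup>]\<close>, for \<open>q = p ^ e\<close>.\<close>

definition frob_power :: "('a, 'b) ring_scheme \<Rightarrow> 'a set \<Rightarrow> nat \<Rightarrow> 'a set" where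
  "frob_power R J q = Idl\<^bsub>R\<^esub> {u [^]\<^bsub>R\<^esub> q | u. u \<in> J}"

definition frob_root :: "('a, 'b) ring_scheme \<Rightarrow> 'a set \<Rightarrow> nat \<Rightarrow> 'a set" where
  "frob_root R \<bb> q = (THE J. ideal J R \<and> \<bb> \<subseteq> frob_power R J q \<and>
     (\<forall>J'. ideal J' R \<and> \<bb> \<subseteq> frob_power R J' q \<longrightarrow> J \<subseteq> J'))"

text \<open>The power of \<open>\<aa>\<close> is taken in the monoid of ideals, so the zeroth power is the unit ideal.
  The smallest ideal above and the stable value below exist, so that both definite descriptions are
  meaningful, when \<open>R\<close> is regular of characteristic \<open>p\<close> and finite free over its subring of
  \<open>p\<close>-th powers, and \<open>t \<ge> 0\<close>.\<close>

definition test_ideal :: "('a, 'b) ring_scheme \<Rightarrow> nat \<Rightarrow> 'a set \<Rightarrow> real \<Rightarrow> 'a set" where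
  "test_ideal R p \<aa> t = (THE J. \<forall>\<^sub>F e in sequentially.
     frob_root R (\<aa> [^]\<^bsub>ideals_set R\<^esub> nat \<lceil>t * real (p ^ e)\<rceil>) (p ^ e) = J)"

end

theory Submission
  imports Defs
begin

text \<open>Coordinates over \<open>R\<^sup>p\<close> give an operator \<open>root\<close> on ideals with
  \<open>root K \<subseteq> J \<longleftrightarrow> K \<subseteq> J\<^sup>[\<^sup>p\<^sup>]\<close>, whose \<open>e\<close>-th iterate is \<open>K \<mapsto> K\<^sup>[\<^sup>1\<^sup>/\<^sup>q\<^sup>]\<close> for
  \<open>q = p ^ e\<close>. If \<open>u \<noteq> v\<close> are basis elements, then replacing two generators \<open>y, z\<close> of an ideal by
  \<open>y\<^sup>p u + z\<^sup>p v\<close>, and every other generator \<open>w\<close> by \<open>w\<^sup>p u\<close>, gives an ideal whose root is the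
  original one; so every ideal is \<open>(f)\<^sup>[\<^sup>1\<^sup>/\<^sup>q\<^sup>]\<close> for some \<open>f\<close>, which is the test ideal of exponent
  \<open>1/q\<close>. (If the basis has one element, \<open>R\<close> is perfect and all ideals are principal.)

  For an \<open>\<mm>\<close>-primary ideal \<open>I = (f)\<^sup>[\<^sup>1\<^sup>/\<^sup>q\<^sup>]\<close> with fewer than \<open>r\<close> generators, the test ideal of
  \<open>f\<close> does not change if the exponent is slightly increased: the exponent \<open>(p ^ k + r) / (q p ^ k)\<close>
  still gives \<open>I\<close> for large \<open>k\<close>. The slack \<open>r\<close> makes, by the pigeonhole principle, all the powers
  of \<open>(f) + I\<^sup>[\<^sup>Q\<^sup>]\<close> that define its test ideal at this exponent small enough, where
  \<open>Q = q p ^ k\<close>.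

  Regularity enters only through the fact that \<open>R\<close> is reduced, which follows from regular local
  rings being domains, hence from Krull's principal ideal theorem.\<close>

no_notation Sum_Type.Plus (infixr \<open><+>\<close> 65)

section \<open>Ideals\<close>

lemma (in cring) ideal_criterion:
  assumes "I \<subseteq> carrier R" "\<zero> \<in> I" "\<And>x y. x \<in> I \<Longrightarrow> y \<in> I \<Longrightarrow> x \<oplus> y \<in> I"
    and "\<And>r x. r \<in> carrier R \<Longrightarrow> x \<in> I \<Longrightarrow> r \<otimes> x \<in> I"
  shows "ideal I R"
proof (rule idealI[OF ring_axioms])
  show "subgroup I (add_monoid R)"
  proof (rule add.subgroupI)
    show "\<ominus> a \<in> I" if "a \<in> I" for a
      using assms(4)[of "\<ominus> \<one>" a] assms(1) that by (auto simp: l_minus)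
  qed (use assms in auto)
next
  fix a x assume "a \<in> I" "x \<in> carrier R"
  then show "x \<otimes> a \<in> I" "a \<otimes> x \<in> I"
    using assms(4)[of x a] assms(1) m_comm[of a x] by auto
qed

lemma ideal_subset: "ideal I R \<Longrightarrow> I \<subseteq> carrier R"
  by (rule subsetI) (rule ideal.Icarr)

lemma (in cring) mem_add_PIdl:
  "y \<in> J <+> PIdl x \<longleftrightarrow> (\<exists>j\<in>J. \<exists>r\<in>carrier R. y = j \<oplus> r \<otimes> x)"
  unfolding set_add_def' cgenideal_def by auto

lemma (in cring) Idl_insert:
  assumes "S \<subseteq> carrier R" "x \<in> carrier R"
  shows "Idl (insert x S) = Idl S <+> PIdl x"
proof -
  have i: "ideal (Idl S) R" "ideal (PIdl x) R" "ideal (Idl S <+> PIdl x) R"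
    "ideal (Idl (insert x S)) R"
    using assms by (auto intro!: genideal_ideal cgenideal_ideal add_ideals)
  have u: "Idl S <+> PIdl x = Idl (Idl S \<union> PIdl x)"
    using union_genideal[OF i(1,2)] by simp
  have sub: "Idl S \<union> PIdl x \<subseteq> carrier R"
    using i(1,2)[THEN ideal_subset] by blast
  show ?thesis
  proof
    have "insert x S \<subseteq> Idl S <+> PIdl x"
      unfolding u using genideal_self[OF assms(1)] cgenideal_self[OF assms(2)]
        genideal_self[OF sub] by auto
    then show "Idl (insert x S) \<subseteq> Idl S <+> PIdl x"
      by (rule genideal_minimal[OF i(3)])
    have "insert x S \<subseteq> Idl (insert x S)"
      using assms by (intro genideal_self) auto
    then have "Idl S \<union> PIdl x \<subseteq> Idl (insert x S)"
      using genideal_minimal[OF i(4), of S] cgenideal_minimal[OF i(4), of x] by auto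
    then show "Idl S <+> PIdl x \<subseteq> Idl (insert x S)"
      unfolding u by (rule genideal_minimal[OF i(4)])
  qed
qed

lemma (in ring) Idl_empty: "Idl {} = {\<zero>}"
  using genideal_minimal[OF zeroideal, of "{}"]
    additive_subgroup.zero_closed[OF ideal.axioms(1)[OF genideal_ideal, of "{}"]] by auto

lemma (in ring) le_add_ideals:
  assumes "ideal I R" "ideal J R"
  shows "I \<subseteq> I <+> J" "J \<subseteq> I <+> J"
proof -
  have "I \<union> J \<subseteq> carrier R"
    using assms[THEN ideal_subset] by blast
  then have "I \<union> J \<subseteq> Idl (I \<union> J)" by (rule genideal_self)
  then show "I \<subseteq> I <+> J" "J \<subseteq> I <+> J"
    using union_genideal[OF assms] by auto
qed

lemma (in ring) add_ideals_le:
  assumes "ideal K R" "I \<subseteq> K" "J \<subseteq> K"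
  shows "I <+> J \<subseteq> K"
  using assms additive_subgroup.a_closed[OF ideal.axioms(1)[OF assms(1)]]
  unfolding set_add_def' by auto

text \<open>The determinant trick, proved by removing one generator of \<open>N\<close> at a time. It specializes to
  Nakayama's lemma over a local ring, at a prime, and for idempotent ideals.\<close>

lemma (in cring) determinant_trick:
  assumes E: "ideal E R" and N: "ideal N R" and t: "t \<in> carrier R"
    and F: "finite F" "F \<subseteq> N" and J: "ideal J R"
    and gen: "N \<subseteq> J <+> Idl F" and tN: "\<And>x. x \<in> N \<Longrightarrow> t \<otimes> x \<in> J <+> E \<cdot> N"
  shows "\<exists>n::nat. \<exists>a\<in>E. \<forall>x\<in>N. (t [^] n \<oplus> a) \<otimes> x \<in> J"
  using F J gen tN
proof (induction F arbitrary: J rule: finite_induct)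
  case empty
  interpret J: ideal J R by fact
  interpret E: ideal E R by fact
  interpret N: ideal N R by fact
  have "(t [^] (0::nat) \<oplus> \<zero>) \<otimes> x \<in> J" if "x \<in> N" for x
  proof -
    have "x \<in> J <+> {\<zero>}" using empty.prems(3) that by (auto simp: Idl_empty)
    then have "x \<in> J" using J.Icarr by (auto simp: set_add_def')
    then show ?thesis using J.Icarr by simp
  qed
  then show ?case using E.zero_closed by blast
next
  case (insert x F)
  interpret J: ideal J R by fact
  interpret E: ideal E R by fact
  interpret N: ideal N R by fact
  have xN: "x \<in> N" and xc: "x \<in> carrier R" and FN: "F \<subseteq> N" and Fc: "F \<subseteq> carrier R"
    using insert.prems N.Icarr by auto
  \<comment> \<open>The generator \<open>x\<close> moves from \<open>F\<close> into
    \<open>J\<close>; the induction hypothesis then yields \<open>?u\<close> with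
    \<open>?u \<otimes> y\<close> in \<open>J <+> PIdl x\<close> for every \<open>y\<close> in
    \<open>N\<close>.\<close>
  let ?J = "J <+> PIdl x"
  have J': "ideal ?J R" using J.is_ideal cgenideal_ideal[OF xc] by (rule add_ideals)
  have le: "J \<subseteq> ?J" using J.is_ideal cgenideal_ideal[OF xc] by (rule le_add_ideals)
  have EN: "ideal (E \<cdot> N) R" using ideal_prod_is_ideal E.is_ideal N.is_ideal by blast
  have g1: "N \<subseteq> ?J <+> Idl F"
  proof
    fix y assume "y \<in> N"
    then have "y \<in> J <+> (Idl F <+> PIdl x)"
      using insert.prems(3) Idl_insert[OF Fc xc] by auto
    then obtain j i r where "j \<in> J" "i \<in> Idl F" "r \<in> carrier R" "y = j \<oplus> (i \<oplus> r \<otimes> x)"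
      unfolding set_add_def'[of _ J] by (auto simp: mem_add_PIdl)
    moreover from this have "y = (j \<oplus> r \<otimes> x) \<oplus> i"
      using J.Icarr ideal.Icarr[OF genideal_ideal[OF Fc]] xc by (simp add: a_ac)
    moreover have "j \<oplus> r \<otimes> x \<in> ?J" using \<open>j \<in> J\<close> \<open>r \<in> carrier R\<close> by (auto simp: mem_add_PIdl)
    ultimately show "y \<in> ?J <+> Idl F" unfolding set_add_def'[of _ ?J] by blast
  qed
  have g2: "t \<otimes> y \<in> ?J <+> E \<cdot> N" if "y \<in> N" for y
    using insert.prems(4)[OF that] le unfolding set_add_def'[of _ _ "E \<cdot> N"] by auto
  obtain n :: nat and a where a: "a \<in> E" and u: "\<And>y. y \<in> N \<Longrightarrow> (t [^] n \<oplus> a) \<otimes> y \<in> ?J"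
    using insert.IH[OF FN J' g1 g2] by auto
  let ?u = "t [^] n \<oplus> a"
  have ac: "a \<in> carrier R" and uc: "?u \<in> carrier R" using a E.Icarr t by auto
  \<comment> \<open>On products \<open>e \<otimes> y\<close> with \<open>e\<close> in
    \<open>E\<close>, the multiple of \<open>x\<close> contained in \<open>?u \<otimes> y\<close>
    acquires a coefficient from \<open>E\<close>.\<close>
  have ENw: "\<exists>j\<in>J. \<exists>e\<in>E. ?u \<otimes> w = j \<oplus> e \<otimes> x" if "w \<in> E \<cdot> N" for w
    using that
  proof (induction rule: ideal_prod.induct)
    case (prod e y)
    then obtain j r where jr: "j \<in> J" "r \<in> carrier R" "?u \<otimes> y = j \<oplus> r \<otimes> x"
      using u[of y] by (auto simp: mem_add_PIdl)
    have ec: "e \<in> carrier R" "y \<in> carrier R" "j \<in> carrier R" using prod jr E.Icarr N.Icarr J.Icarr by auto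
    have "?u \<otimes> (e \<otimes> y) = e \<otimes> (?u \<otimes> y)" using ec uc by (simp add: m_lcomm)
    also have "\<dots> = e \<otimes> j \<oplus> (e \<otimes> r) \<otimes> x" using ec jr(2) xc by (simp add: jr(3) r_distr m_assoc)
    finally show ?case
      using J.I_l_closed[OF jr(1) ec(1)] E.I_r_closed[OF prod(1) jr(2)] by blast
  next
    case (sum w1 w2)
    then obtain j1 e1 j2 e2 where *: "j1 \<in> J" "e1 \<in> E" "?u \<otimes> w1 = j1 \<oplus> e1 \<otimes> x"
       "j2 \<in> J" "e2 \<in> E" "?u \<otimes> w2 = j2 \<oplus> e2 \<otimes> x" by blast
    have c: "w1 \<in> carrier R" "w2 \<in> carrier R" "j1 \<in> carrier R" "j2 \<in> carrier R"
      "e1 \<in> carrier R" "e2 \<in> carrier R"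
      using * sum ideal.Icarr[OF EN] J.Icarr E.Icarr by auto
    have "?u \<otimes> (w1 \<oplus> w2) = (j1 \<oplus> e1 \<otimes> x) \<oplus> (j2 \<oplus> e2 \<otimes> x)"
      using c uc by (simp add: r_distr *)
    also have "\<dots> = (j1 \<oplus> j2) \<oplus> (e1 \<oplus> e2) \<otimes> x" using c xc by (simp add: l_distr a_ac)
    finally show ?case using * by blast
  qed
  obtain j w where jw: "j \<in> J" "w \<in> E \<cdot> N" "t \<otimes> x = j \<oplus> w"
    using insert.prems(4)[OF xN] unfolding set_add_def' by auto
  obtain j' e where je: "j' \<in> J" "e \<in> E" "?u \<otimes> w = j' \<oplus> e \<otimes> x" using ENw[OF jw(2)] by blast
  have c: "j \<in> carrier R" "w \<in> carrier R" "j' \<in> carrier R" "e \<in> carrier R"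
    using jw je J.Icarr E.Icarr ideal.Icarr[OF EN] by auto
  \<comment> \<open>Multiplying \<open>t \<otimes> x = j \<oplus> w\<close> by \<open>?u\<close>
    gives \<open>?u \<otimes> t \<otimes> x = e \<otimes> x\<close> modulo \<open>J\<close>, so
    \<open>?v\<close> carries \<open>x\<close> into \<open>J\<close>. Hence
    \<open>?v \<otimes> ?u\<close> carries all of \<open>N\<close> into \<open>J\<close>.\<close>
  let ?v = "?u \<otimes> t \<ominus> e"
  have vc: "?v \<in> carrier R" using uc t c by simp
  have "?u \<otimes> t \<otimes> x = ?u \<otimes> j \<oplus> (j' \<oplus> e \<otimes> x)"
    using uc t xc c jw(3) je(3) by (simp add: m_assoc r_distr)
  then have "?v \<otimes> x = ?u \<otimes> j \<oplus> (j' \<oplus> e \<otimes> x) \<ominus> e \<otimes> x"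
    using uc t xc c by (simp add: a_minus_def l_distr l_minus)
  also have "\<dots> = ?u \<otimes> j \<oplus> j'" using uc c xc by (simp add: a_minus_def a_assoc r_neg)
  finally have vx: "?v \<otimes> x \<in> J" using J.I_l_closed[OF jw(1) uc] je(1) by simp
  have "(?v \<otimes> ?u) \<otimes> y \<in> J" if y: "y \<in> N" for y
  proof -
    obtain i r where ir: "i \<in> J" "r \<in> carrier R" "?u \<otimes> y = i \<oplus> r \<otimes> x"
      using u[OF y] by (auto simp: mem_add_PIdl)
    have "(?v \<otimes> ?u) \<otimes> y = ?v \<otimes> i \<oplus> r \<otimes> (?v \<otimes> x)"
      using vc uc N.Icarr[OF y] J.Icarr[OF ir(1)] ir xc by (simp add: m_assoc r_distr m_lcomm)
    then show ?thesis
      using J.I_l_closed[OF ir(1) vc] J.I_l_closed[OF vx ir(2)] by simp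
  qed
  \<comment> \<open>The multiplier keeps its shape: modulo \<open>E\<close>, \<open>?v\<close> is
    the power \<open>n + 1\<close> of \<open>t\<close> and \<open>?u\<close> is the power
    \<open>n\<close>.\<close>
  moreover have "?v \<otimes> ?u = t [^] (n + 1 + n) \<oplus>
      ((t [^] n \<otimes> t) \<otimes> a \<oplus> (a \<otimes> t \<ominus> e) \<otimes> ?u)"
  proof -
    have "?v = t [^] n \<otimes> t \<oplus> (a \<otimes> t \<ominus> e)"
      using t ac c by (simp add: l_distr a_minus_def a_assoc)
    then show ?thesis using t ac c
      by (simp add: l_distr r_distr nat_pow_mult[symmetric] m_ac a_ac)
  qed
  moreover have "(t [^] n \<otimes> t) \<otimes> a \<oplus> (a \<otimes> t \<ominus> e) \<otimes> ?u \<in> E"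
    using a je(2) t uc by (simp add: E.I_l_closed E.I_r_closed a_minus_def)
  ultimately show ?case by metis
qed

section \<open>Maximal elements of families of ideals\<close>

locale noetherian_cring = cring + noetherian_ring

text \<open>Zorn's lemma applies because a nonempty chain of ideals of a Noetherian ring contains
  its own union.\<close>

lemma (in noetherian_ring) exists_maximal_ideal_in:
  assumes "P J" and P: "\<And>K. P K \<Longrightarrow> ideal K R"
  obtains M where "P M" "\<And>K. P K \<Longrightarrow> M \<subseteq> K \<Longrightarrow> K = M"
proof -
  have "\<exists>M\<in>Collect P. \<forall>K\<in>Collect P. M \<subseteq> K \<longrightarrow> K = M"
  proof (rule subset_Zorn_nonempty)
    show "Collect P \<noteq> {}" using assms(1) by auto
    fix C assume C: "C \<noteq> {}" "subset.chain (Collect P) C"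
    then have "subset.chain {K. ideal K R} C"
      using P unfolding pred_on.chain_def by auto
    then have "\<Union>C \<in> C" using ideal_chain_is_trivial C(1) by blast
    then show "\<Union>C \<in> Collect P" using C(2) unfolding pred_on.chain_def by auto
  qed
  then show ?thesis using that by auto
qed

lemma (in noetherian_ring) exists_maximalideal:
  assumes "ideal J R" "J \<noteq> carrier R"
  shows "\<exists>M. maximalideal M R \<and> J \<subseteq> M"
proof -
  obtain M where M: "ideal M R" "M \<noteq> carrier R" "J \<subseteq> M"
    and max: "\<And>K. ideal K R \<Longrightarrow> K \<noteq> carrier R \<Longrightarrow> J \<subseteq> K \<Longrightarrow> M \<subseteq> K \<Longrightarrow> K = M"
  proof (rule exists_maximal_ideal_in[of "\<lambda>K. ideal K R \<and> K \<noteq> carrier R \<and> J \<subseteq> K" J])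
    show "ideal J R \<and> J \<noteq> carrier R \<and> J \<subseteq> J" using assms by simp
  next
    fix M assume "ideal M R \<and> M \<noteq> carrier R \<and> J \<subseteq> M"
      and "\<And>K. ideal K R \<and> K \<noteq> carrier R \<and> J \<subseteq> K \<Longrightarrow> M \<subseteq> K \<Longrightarrow> K = M"
    then show thesis by (intro that[of M]) auto
  qed simp
  have "maximalideal M R"
    using M max by (intro maximalidealI) blast+
  then show ?thesis using M(3) by blast
qed

section \<open>Saturation at a prime ideal\<close>

text \<open>For prime \<open>M\<close>, this is the contraction to \<open>R\<close> of the extension
  of \<open>K\<close> to the localization at \<open>M\<close>. It allows local arguments to be
  carried out with ideals of \<open>R\<close>.\<close>

definition saturation :: "('a, 'b) ring_scheme \<Rightarrow> 'a set \<Rightarrow> 'a set \<Rightarrow> 'a set" where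
  "saturation R M K = {x \<in> carrier R. \<exists>s\<in>carrier R - M. s \<otimes>\<^bsub>R\<^esub> x \<in> K}"

lemma (in primeideal) compl_mult:
  "s \<in> carrier R - I \<Longrightarrow> t \<in> carrier R - I \<Longrightarrow> s \<otimes> t \<in> carrier R - I"
  using I_prime by auto

lemma (in primeideal) one_compl: "\<one> \<in> carrier R - I"
  using one_imp_carrier I_notcarr by auto

lemma (in primeideal) compl_pow: "t \<in> carrier R - I \<Longrightarrow> t [^] (n::nat) \<in> carrier R - I"
  by (induction n) (use compl_mult one_compl in auto)

lemma (in primeideal) compl_add:
  assumes "t \<in> carrier R - I" "a \<in> I"
  shows "t \<oplus> a \<in> carrier R - I"
proof -
  have "t = (t \<oplus> a) \<oplus> \<ominus> a" using assms Icarr by (simp add: a_assoc r_neg)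
  moreover have "(t \<oplus> a) \<oplus> \<ominus> a \<in> I" if "t \<oplus> a \<in> I"
    using additive_subgroup.a_closed[OF additive_subgroup_axioms that]
      additive_subgroup.a_inv_closed[OF additive_subgroup_axioms assms(2)] by blast
  ultimately have "t \<oplus> a \<in> I \<Longrightarrow> t \<in> I" by simp
  then show ?thesis using assms Icarr by auto
qed

lemma (in cring) saturation_ideal:
  assumes "primeideal M R" "ideal K R"
  shows "ideal (saturation R M K) R"
proof -
  interpret M: primeideal M R by fact
  interpret K: ideal K R by fact
  show ?thesis
  proof (rule ideal_criterion)
    show "\<zero> \<in> saturation R M K"
      using M.one_compl K.zero_closed by (force simp: saturation_def)
    show "x \<oplus> y \<in> saturation R M K" if "x \<in> saturation R M K" "y \<in> saturation R M K" for x y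
    proof -
      obtain s t where *: "x \<in> carrier R" "y \<in> carrier R" "s \<in> carrier R - M" "t \<in> carrier R - M"
        "s \<otimes> x \<in> K" "t \<otimes> y \<in> K" using \<open>x \<in> _\<close> \<open>y \<in> _\<close> unfolding saturation_def by auto
      have "(s \<otimes> t) \<otimes> (x \<oplus> y) = t \<otimes> (s \<otimes> x) \<oplus> s \<otimes> (t \<otimes> y)"
        using * by (auto simp: r_distr m_ac)
      also have "\<dots> \<in> K"
        using K.a_closed[OF K.I_l_closed[OF *(5), of t] K.I_l_closed[OF *(6), of s]] *(3,4) by auto
      finally show ?thesis using M.compl_mult *(1-4) unfolding saturation_def by blast
    qed
    show "r \<otimes> x \<in> saturation R M K" if "r \<in> carrier R" "x \<in> saturation R M K" for r x
    proof -
      obtain s where *: "x \<in> carrier R" "s \<in> carrier R - M" "s \<otimes> x \<in> K"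
        using \<open>x \<in> _\<close> unfolding saturation_def by auto
      then have "s \<otimes> (r \<otimes> x) = r \<otimes> (s \<otimes> x)" using \<open>r \<in> _\<close> by (auto simp: m_ac)
      also have "\<dots> \<in> K" using K.I_l_closed[OF *(3) \<open>r \<in> _\<close>] .
      finally show ?thesis using * \<open>r \<in> _\<close> unfolding saturation_def by auto
    qed
  qed (auto simp: saturation_def)
qed

lemma (in cring) saturation_mono: "K \<subseteq> L \<Longrightarrow> saturation R M K \<subseteq> saturation R M L"
  unfolding saturation_def by auto

lemma (in cring) le_saturation:
  assumes "primeideal M R" "ideal K R"
  shows "K \<subseteq> saturation R M K"
proof -
  interpret M: primeideal M R by fact
  interpret K: ideal K R by fact
  show ?thesis using M.one_compl K.Icarr unfolding saturation_def by force
qed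

lemma (in cring) saturation_saturated:
  assumes "primeideal M R" "s \<in> carrier R - M" "x \<in> carrier R" "s \<otimes> x \<in> saturation R M K"
  shows "x \<in> saturation R M K"
proof -
  interpret M: primeideal M R by fact
  obtain t where t: "t \<in> carrier R - M" "t \<otimes> (s \<otimes> x) \<in> K"
    using assms(4) unfolding saturation_def by auto
  then have "(t \<otimes> s) \<otimes> x \<in> K" using assms by (auto simp: m_assoc)
  then show ?thesis using M.compl_mult[OF t(1) assms(2)] assms(3) unfolding saturation_def by blast
qed

text \<open>The product of the denominators of the finitely many elements of \<open>F\<close> serves
  for all of them, and the elements that a fixed \<open>t\<close> multiplies into \<open>K\<close>
  form an ideal.\<close>

lemma (in cring) uniform_denominator:
  assumes "primeideal M R" "ideal K R" "finite F" "F \<subseteq> saturation R M K"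
  shows "\<exists>t\<in>carrier R - M. \<forall>x\<in>Idl F. t \<otimes> x \<in> K"
proof -
  interpret M: primeideal M R by fact
  interpret K: ideal K R by fact
  have "\<exists>t\<in>carrier R - M. \<forall>x\<in>F. t \<otimes> x \<in> K"
    using assms(3,4)
  proof (induction F)
    case empty
    then show ?case using M.one_compl by blast
  next
    case (insert x F)
    then obtain t where t: "t \<in> carrier R - M" "\<forall>x\<in>F. t \<otimes> x \<in> K" by auto
    obtain s where s: "s \<in> carrier R - M" "s \<otimes> x \<in> K"
      using insert.prems unfolding saturation_def by auto
    have c: "x \<in> carrier R" "F \<subseteq> carrier R" using insert.prems unfolding saturation_def by auto
    have "s \<otimes> t \<otimes> y \<in> K" if "y \<in> insert x F" for y
    proof (cases "y = x")
      case True
      have "s \<otimes> t \<otimes> x = t \<otimes> (s \<otimes> x)" using s t c by (auto simp: m_ac)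
      then show ?thesis using True K.I_l_closed[OF s(2)] t(1) by auto
    next
      case False
      then have "y \<in> F" using that by simp
      then have "s \<otimes> t \<otimes> y = s \<otimes> (t \<otimes> y)" using s t c by (auto simp: m_assoc)
      then show ?thesis using K.I_l_closed[of "t \<otimes> y" s] s(1) t(2) \<open>y \<in> F\<close> by auto
    qed
    then show ?case using M.compl_mult[OF s(1) t(1)] by blast
  qed
  then obtain t where t: "t \<in> carrier R - M" "\<forall>x\<in>F. t \<otimes> x \<in> K" by blast
  have "ideal {x \<in> carrier R. t \<otimes> x \<in> K} R"
    using K.helper_max_prime[OF is_cring] t(1) by auto
  moreover have "F \<subseteq> {x \<in> carrier R. t \<otimes> x \<in> K}"
    using t(2) assms(4) unfolding saturation_def by auto
  ultimately have "Idl F \<subseteq> {x \<in> carrier R. t \<otimes> x \<in> K}" by (rule genideal_minimal)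
  then show ?thesis using t(1) by blast
qed

text \<open>If \<open>M\<close> is minimal over \<open>A\<close>, then \<open>R\<^sub>M / A\<^sub>M\<close> is Artinian.\<close>

lemma (in noetherian_cring) saturated_descending_stabilizes:
  assumes M: "primeideal M R"
    and minimal: "\<And>Q. primeideal Q R \<Longrightarrow> A \<subseteq> Q \<Longrightarrow> Q \<subseteq> M \<Longrightarrow> Q = M"
    and L: "\<And>n. ideal (L n) R" "\<And>n. saturation R M (L n) \<subseteq> L n" "\<And>n. A \<subseteq> L n"
      "\<And>n::nat. L (Suc n) \<subseteq> L n" and A: "ideal A R"
  shows "\<exists>n. L (Suc n) = L n"
proof (rule ccontr)
  assume neq: "\<nexists>n. L (Suc n) = L n"
  interpret M: primeideal M R by fact
  \<comment> \<open>Noetherian induction on the bottom ideal: \<open>chain a L\<close> is a strictly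
    descending sequence of saturated ideals above \<open>a\<close>, and a maximal saturated
    \<open>a\<close> over \<open>A\<close> admitting such a sequence is refuted.\<close>
  define chain where "chain a L \<longleftrightarrow> (\<forall>n. ideal (L n) R \<and> saturation R M (L n) \<subseteq> L n \<and> a \<subseteq> L n
    \<and> L (Suc n) \<subset> L n)" for a and L :: "nat \<Rightarrow> 'a set"
  define bad where "bad = {a. ideal a R \<and> A \<subseteq> a \<and> saturation R M a \<subseteq> a \<and> (\<exists>L. chain a L)}"
  have "chain (saturation R M A) L"
    unfolding chain_def
  proof (intro allI conjI)
    fix n
    show "saturation R M A \<subseteq> L n" using saturation_mono[OF L(3)] L(2) by blast
    show "L (Suc n) \<subset> L n" using L(4)[of n] neq by (simp add: psubset_eq)
  qed (use L in auto)
  moreover have "saturation R M (saturation R M A) \<subseteq> saturation R M A"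
  proof
    fix x assume "x \<in> saturation R M (saturation R M A)"
    then obtain s where "x \<in> carrier R" "s \<in> carrier R - M" "s \<otimes> x \<in> saturation R M A"
      unfolding saturation_def[of _ _ "saturation R M A"] by auto
    then show "x \<in> saturation R M A" using saturation_saturated[OF M] by blast
  qed
  ultimately have badA: "saturation R M A \<in> bad"
    using saturation_ideal[OF M A] le_saturation[OF M A] unfolding bad_def by auto
  have badI: "ideal a R" if "a \<in> bad" for a using that unfolding bad_def by auto
  obtain a where a: "a \<in> bad" and amax: "\<And>c. c \<in> bad \<Longrightarrow> a \<subseteq> c \<Longrightarrow> c = a"
    using exists_maximal_ideal_in[of "\<lambda>a. a \<in> bad", OF badA badI] by auto
  interpret a: ideal a R using badI a by blast
  obtain K where K: "chain a K" and Aa: "A \<subseteq> a" and sata: "saturation R M a \<subseteq> a"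
    using a unfolding bad_def by auto
  have Ki: "ideal (K n) R" and Ks: "saturation R M (K n) \<subseteq> K n" and aK: "a \<subseteq> K n"
    and Kd: "K (Suc n) \<subset> K n" for n
    using K unfolding chain_def by auto
  have KK: "K m \<subseteq> K n" if "n \<le> m" for n m
    using that by (induction rule: dec_induct) (use Kd in auto)
  have "a \<noteq> carrier R"
    using aK[of "Suc 0"] Kd[of 0] ideal_subset[OF Ki[of 0]] by auto
  then have one: "\<one> \<notin> a" using a.one_imp_carrier by auto
  \<comment> \<open>This is \<open>(a : x)\<close>. A maximal one among those with \<open>x\<close>
    outside \<open>a\<close> is prime: it is an associated prime of \<open>R / a\<close>.\<close>
  define colon where "colon x = {y \<in> carrier R. x \<otimes> y \<in> a}" for x
  have colon_ideal: "ideal (colon x) R" if "x \<in> carrier R" for x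
    unfolding colon_def by (rule a.helper_max_prime[OF is_cring that])
  obtain x where x: "x \<in> carrier R" "x \<notin> a"
    and xmax: "\<And>y. y \<in> carrier R \<Longrightarrow> y \<notin> a \<Longrightarrow> colon x \<subseteq> colon y \<Longrightarrow> colon y = colon x"
  proof (rule exists_maximal_ideal_in[of "\<lambda>c. \<exists>x. x \<in> carrier R \<and> x \<notin> a \<and> c = colon x" "colon \<one>"])
    show "\<exists>x. x \<in> carrier R \<and> x \<notin> a \<and> colon \<one> = colon x" using one by blast
    fix c assume "\<exists>x. x \<in> carrier R \<and> x \<notin> a \<and> c = colon x"
    then show "ideal c R" using colon_ideal by auto
  next
    fix c assume "\<exists>x. x \<in> carrier R \<and> x \<notin> a \<and> c = colon x"
      and "\<And>K. \<exists>x. x \<in> carrier R \<and> x \<notin> a \<and> K = colon x \<Longrightarrow> c \<subseteq> K \<Longrightarrow> K = c"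
    then show thesis using that by (metis (no_types, lifting))
  qed
  have "primeideal (colon x) R"
  proof (rule primeidealI[OF colon_ideal[OF x(1)] is_cring])
    have "\<one> \<notin> colon x" using x unfolding colon_def by auto
    then show "carrier R \<noteq> colon x" by auto
    fix y z assume yz: "y \<in> carrier R" "z \<in> carrier R" "y \<otimes> z \<in> colon x"
    show "y \<in> colon x \<or> z \<in> colon x"
    proof (cases "y \<in> colon x")
      case False
      then have "x \<otimes> y \<notin> a" using yz unfolding colon_def by auto
      moreover have "colon x \<subseteq> colon (x \<otimes> y)"
      proof
        fix w assume w: "w \<in> colon x"
        then have "x \<otimes> y \<otimes> w = y \<otimes> (x \<otimes> w)" using x yz unfolding colon_def by (auto simp: m_ac)
        then show "w \<in> colon (x \<otimes> y)" using w a.I_l_closed yz unfolding colon_def by auto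
      qed
      ultimately have "colon (x \<otimes> y) = colon x" using xmax x yz by auto
      moreover have "z \<in> colon (x \<otimes> y)"
        using yz x unfolding colon_def by (auto simp: m_assoc)
      ultimately show ?thesis by simp
    qed simp
  qed
  moreover have "A \<subseteq> colon x" using Aa a.Icarr a.I_l_closed x(1) unfolding colon_def by auto
  \<comment> \<open>Here it matters that \<open>a\<close> is saturated. Minimality of
    \<open>M\<close> over \<open>A\<close> then gives \<open>colon x = M\<close>, so
    \<open>x\<close> generates a copy of the residue field of \<open>M\<close> in the localization
    of \<open>R / a\<close>.\<close>
  moreover have "colon x \<subseteq> M"
  proof
    fix s assume s: "s \<in> colon x"
    show "s \<in> M"
    proof (rule ccontr)
      assume "s \<notin> M"
      then have "x \<in> saturation R M a"
        using s x(1) unfolding colon_def saturation_def by (auto simp: m_comm)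
      then show False using sata x(2) by auto
    qed
  qed
  ultimately have colon_eq: "colon x = M" by (rule minimal)
  have Px: "ideal (PIdl x) R" using cgenideal_ideal x(1) by blast
  \<comment> \<open>By maximality of \<open>a\<close>, this strictly larger saturated ideal has no
    strictly descending sequence of saturated ideals above it.\<close>
  define a' where "a' = saturation R M (a <+> PIdl x)"
  have ia: "ideal (a <+> PIdl x) R" using add_ideals a.is_ideal Px by blast
  have a'i: "ideal a' R" unfolding a'_def by (rule saturation_ideal[OF M ia])
  have aa': "a <+> PIdl x \<subseteq> a'" unfolding a'_def by (rule le_saturation[OF M ia])
  have aa'2: "a \<subseteq> a'" using aa' le_add_ideals(1)[OF a.is_ideal Px] by auto
  have "x \<in> a'" using aa' le_add_ideals(2)[OF a.is_ideal Px] cgenideal_self[OF x(1)] by auto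
  then have "a' \<notin> bad" using amax[of a'] aa'2 x(2) by auto
  moreover have "saturation R M a' \<subseteq> a'"
  proof
    fix x assume "x \<in> saturation R M a'"
    then show "x \<in> a'" using saturation_saturated[OF M] unfolding a'_def
      by (auto simp: saturation_def[of _ _ "saturation R M _"])
  qed
  ultimately have nochain: "\<not> chain a' L" for L using a'i Aa aa'2 unfolding bad_def by auto
  show False
  proof (cases "\<forall>n. x \<in> K n")
    case True
    have "a' \<subseteq> K n" for n
    proof -
      have "a <+> PIdl x \<subseteq> K n"
        using add_ideals_le[OF Ki aK cgenideal_minimal[OF Ki]] True by blast
      then show ?thesis using saturation_mono Ks unfolding a'_def by blast
    qed
    then have "chain a' K" using K unfolding chain_def by auto
    then show False using nochain by blast
  next
    case False
    then obtain m where m: "x \<notin> K m" by blast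
    \<comment> \<open>From index \<open>m\<close> on, \<open>x\<close> lies outside the ideals
      \<open>K\<close>. Adjoining it and saturating gives ideals above \<open>a'\<close>, so two
      consecutive ones coincide; this is then pulled back to two consecutive
      \<open>K\<close>.\<close>
    define L where "L n = saturation R M (K (n + m) <+> PIdl x)" for n
    have iK: "ideal (K n <+> PIdl x) R" for n using add_ideals Ki Px by blast
    have "\<exists>n. \<not> L (Suc n) \<subset> L n"
    proof (rule ccontr)
      assume *: "\<nexists>n. \<not> L (Suc n) \<subset> L n"
      have "chain a' L" unfolding chain_def
      proof (intro allI conjI)
        fix n
        show "ideal (L n) R" unfolding L_def by (rule saturation_ideal[OF M iK])
        show "saturation R M (L n) \<subseteq> L n"
        proof
          fix x assume "x \<in> saturation R M (L n)"
          then show "x \<in> L n" using saturation_saturated[OF M] unfolding L_def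
            by (auto simp: saturation_def[of _ _ "saturation R M _"])
        qed
        have "a <+> PIdl x \<subseteq> K (n + m) <+> PIdl x"
          using aK unfolding set_add_def' by blast
        then show "a' \<subseteq> L n" unfolding a'_def L_def by (rule saturation_mono)
        show "L (Suc n) \<subset> L n" using * by blast
      qed
      then show False using nochain by blast
    qed
    moreover have "L (Suc n) \<subseteq> L n" for n
    proof -
      have "K (Suc n + m) <+> PIdl x \<subseteq> K (n + m) <+> PIdl x"
        using Kd[of "n + m"] unfolding set_add_def' by auto
      then show ?thesis unfolding L_def by (rule saturation_mono)
    qed
    ultimately obtain n where n: "L (Suc n) = L n" by blast
    have xn: "x \<notin> K (n + m)" using m KK[of m "n + m"] by auto
    have "K (n + m) \<subseteq> K (Suc (n + m))"
    proof
      fix y assume y: "y \<in> K (n + m)"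
      then have yc: "y \<in> carrier R" using ideal_subset[OF Ki] by auto
      have "y \<in> L n" using y le_saturation[OF M iK] le_add_ideals(1)[OF Ki Px]
        unfolding L_def by blast
      then have "y \<in> L (Suc n)" using n by simp
      then obtain s l r where s: "s \<in> carrier R - M" "l \<in> K (Suc (n + m))" "r \<in> carrier R"
        "s \<otimes> y = l \<oplus> r \<otimes> x" unfolding L_def saturation_def by (auto simp: mem_add_PIdl)
      interpret K1: ideal "K (n + m)" R by (rule Ki)
      interpret K2: ideal "K (Suc (n + m))" R by (rule Ki)
      have lK: "l \<in> K (n + m)" using s(2) Kd[of "n + m"] by auto
      have "r \<otimes> x = s \<otimes> y \<ominus> l"
        using s x(1) K1.Icarr[OF lK] by (simp add: a_minus_def a_ac r_neg1 r_neg2)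
      then have "r \<otimes> x \<in> K (n + m)"
        using K1.I_l_closed[OF y] s(1) lK by (auto simp: a_minus_def)
      \<comment> \<open>Otherwise \<open>x\<close> would lie in the saturated ideal
        \<open>K (n + m)\<close>. Since \<open>M\<close> is \<open>colon x\<close>, the product
        \<open>r \<otimes> x\<close> falls into \<open>a\<close>, hence into the next ideal of the
        chain.\<close>
      then have "r \<in> M"
        using Ks[of "n + m"] xn s(3) x(1) by (auto simp: saturation_def)
      then have "r \<in> colon x" by (simp only: colon_eq)
      then have "r \<otimes> x \<in> a" using s(3) x(1) unfolding colon_def by (simp add: m_comm)
      then have "s \<otimes> y \<in> K (Suc (n + m))"
        using aK[of "Suc (n + m)"] s(2,4) K2.a_closed by auto
      then show "y \<in> K (Suc (n + m))"
        using Ks[of "Suc (n + m)"] s(1) yc by (auto simp: saturation_def)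
    qed
    then show False using Kd[of "n + m"] by auto
  qed
qed

section \<open>Powers of ideals\<close>

abbreviation ideal_pow :: "('a, 'b) ring_scheme \<Rightarrow> 'a set \<Rightarrow> nat \<Rightarrow> 'a set" where
  "ideal_pow R K n \<equiv> K [^]\<^bsub>ideals_set R\<^esub> n"

lemma ideals_set_one [simp]: "\<one>\<^bsub>ideals_set R\<^esub> = carrier R"
  by (simp add: ideals_set_def)

lemma ideals_set_mult [simp]: "K \<otimes>\<^bsub>ideals_set R\<^esub> L = K \<cdot>\<^bsub>R\<^esub> L"
  by (simp add: ideals_set_def)

lemma (in cring) ideal_pow_ideal: "ideal K R \<Longrightarrow> ideal (ideal_pow R K n) R"
  by (induction n) (auto simp: oneideal ideal_prod_is_ideal)

lemma (in cring) pow_mem_ideal_pow: "ideal K R \<Longrightarrow> x \<in> K \<Longrightarrow> x [^] n \<in> ideal_pow R K n"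
  by (induction n) (auto intro: ideal_prod.prod)

lemma (in primeideal) pow_mem: "x \<in> carrier R \<Longrightarrow> x [^] (n::nat) \<in> I \<Longrightarrow> x \<in> I"
proof (induction n)
  case 0
  then show ?case using one_imp_carrier I_notcarr by auto
next
  case (Suc n)
  then show ?case using I_prime[of "x [^] n" x] by auto
qed

section \<open>Krull's principal ideal theorem\<close>

text \<open>This is Krull's theorem for \<open>R / P\<close> localized at \<open>M\<close>: a
  failure makes \<open>M\<close> minimal over \<open>P <+> PIdl b\<close>. The symbolic powers of
  \<open>Q\<close> modulo \<open>P\<close> then stabilize up to multiples of \<open>b\<close>;
  Nakayama's lemma at \<open>M\<close> removes \<open>b\<close>, and Nakayama's lemma at
  \<open>Q\<close> yields the contradiction \<open>Q \<subseteq> P\<close>.\<close>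

lemma (in noetherian_cring) krull_principal:
  assumes P: "primeideal P R" and Q: "primeideal Q R" and M: "primeideal M R"
    and PQ: "P \<subset> Q" and QM: "Q \<subset> M" and b: "b \<in> M"
  shows "\<exists>Q'. primeideal Q' R \<and> P \<subset> Q' \<and> Q' \<subset> M \<and> b \<in> Q'"
proof (rule ccontr)
  assume none: "\<nexists>Q'. primeideal Q' R \<and> P \<subset> Q' \<and> Q' \<subset> M \<and> b \<in> Q'"
  interpret P: primeideal P R by fact
  interpret Q: primeideal Q R by fact
  interpret M: primeideal M R by fact
  have bQ: "b \<notin> Q" using none PQ QM Q by blast
  have bc: "b \<in> carrier R" using M.Icarr b by auto
  have ib: "ideal (PIdl b) R" using cgenideal_ideal bc by blast
  define A where "A = P <+> PIdl b"
  have A: "ideal A R" unfolding A_def using add_ideals P.is_ideal ib by blast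
  have minimal: "Q' = M" if Q': "primeideal Q' R" "A \<subseteq> Q'" "Q' \<subseteq> M" for Q'
  proof -
    have "P \<subseteq> Q'" "b \<in> Q'"
      using le_add_ideals[OF P.is_ideal ib] Q'(2) cgenideal_self[OF bc] unfolding A_def by auto
    then show ?thesis using none Q' bQ PQ by blast
  qed
  \<comment> \<open>The \<open>n\<close>-th symbolic power of \<open>Q\<close> modulo
    \<open>P\<close>, pulled back to \<open>R\<close>.\<close>
  define S where "S n = saturation R Q (ideal_pow R Q n <+> P)" for n
  have iQ: "ideal (ideal_pow R Q n) R" for n by (rule ideal_pow_ideal[OF Q.is_ideal])
  have iQP: "ideal (ideal_pow R Q n <+> P) R" for n using add_ideals iQ P.is_ideal by blast
  have iS: "ideal (S n) R" for n unfolding S_def by (rule saturation_ideal[OF Q iQP])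
  have satS: "x \<in> S n" if "s \<in> carrier R - Q" "x \<in> carrier R" "s \<otimes> x \<in> S n" for s x n
    using saturation_saturated[OF Q that(1,2)] that(3) unfolding S_def by blast
  have PS: "P \<subseteq> S n" for n
    using le_saturation[OF Q iQP] le_add_ideals(2)[OF iQ P.is_ideal] unfolding S_def by blast
  have Qdec: "ideal_pow R Q (Suc n) \<subseteq> ideal_pow R Q n" for n
    using ideal_prod_inter[OF iQ Q.is_ideal] by auto
  have Sdec: "S (Suc n) \<subseteq> S n" for n
  proof -
    have "ideal_pow R Q (Suc n) <+> P \<subseteq> ideal_pow R Q n <+> P"
      using Qdec unfolding set_add_def' by blast
    then show ?thesis unfolding S_def by (rule saturation_mono)
  qed
  define L where "L n = saturation R M (S n <+> PIdl b)" for n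
  have iSb: "ideal (S n <+> PIdl b) R" for n using add_ideals iS ib by blast
  have "\<exists>n. L (Suc n) = L n"
  proof (rule saturated_descending_stabilizes[OF M minimal])
    show "ideal (L n) R" for n unfolding L_def by (rule saturation_ideal[OF M iSb])
    show "saturation R M (L n) \<subseteq> L n" for n
    proof
      fix x assume "x \<in> saturation R M (L n)"
      then show "x \<in> L n" using saturation_saturated[OF M] unfolding L_def
        by (auto simp: saturation_def[of _ _ "saturation R M _"])
    qed
    show "A \<subseteq> L n" for n
    proof -
      have "A \<subseteq> S n <+> PIdl b" using PS unfolding A_def set_add_def' by blast
      then show ?thesis using le_saturation[OF M iSb] unfolding L_def by blast
    qed
    show "L (Suc n) \<subseteq> L n" for n
    proof -
      have "S (Suc n) <+> PIdl b \<subseteq> S n <+> PIdl b" using Sdec unfolding set_add_def' by blast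
      then show ?thesis unfolding L_def by (rule saturation_mono)
    qed
  qed (use A in auto)
  then obtain n where n: "L (Suc n) = L n" by blast
  have iMS: "ideal (M \<cdot> S n) R" using ideal_prod_is_ideal[OF M.is_ideal iS] .
  have iT: "ideal (S (Suc n) <+> M \<cdot> S n) R" using add_ideals[OF iS iMS] .
  \<comment> \<open>Stabilization writes \<open>s \<otimes> x\<close> as
    \<open>y \<oplus> r \<otimes> b\<close> with \<open>r \<otimes> b\<close> in \<open>S n\<close>.
    As \<open>b\<close> is outside \<open>Q\<close> and \<open>S n\<close> is saturated at
    \<open>Q\<close>, also \<open>r\<close> is in \<open>S n\<close>, so the last summand lies in
    \<open>M \<cdot> S n\<close>.\<close>
  have Ssat: "S n \<subseteq> saturation R M (S (Suc n) <+> M \<cdot> S n)"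
  proof
    fix x assume x: "x \<in> S n"
    interpret S: ideal "S n" R by (rule iS)
    have xc: "x \<in> carrier R" using S.Icarr x by auto
    have "x \<in> L n"
      using x le_saturation[OF M iSb] le_add_ideals(1)[OF iS ib] unfolding L_def by blast
    then have "x \<in> L (Suc n)" using n by simp
    then obtain s y r where s: "s \<in> carrier R - M" "y \<in> S (Suc n)" "r \<in> carrier R"
      "s \<otimes> x = y \<oplus> r \<otimes> b" unfolding L_def saturation_def by (auto simp: mem_add_PIdl)
    have yS: "y \<in> S n" using s(2) Sdec by auto
    have "r \<otimes> b = s \<otimes> x \<ominus> y"
      using s bc xc S.Icarr[OF yS] by (simp add: a_minus_def a_ac r_neg1 r_neg2)
    moreover have "s \<otimes> x \<ominus> y \<in> S n"
      unfolding a_minus_def using S.I_l_closed[OF x, of s] s(1) yS by simp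
    ultimately have "b \<otimes> r \<in> S n" using s(3) bc by (simp add: m_comm)
    then have "r \<in> S n" using satS[of b r n] bQ bc s(3) by auto
    then have "r \<otimes> b \<in> M \<cdot> S n"
      using ideal_prod.prod[OF b, of r "S n" R] bc s(3) by (simp add: m_comm)
    then have "s \<otimes> x \<in> S (Suc n) <+> M \<cdot> S n"
      using s(2,4) unfolding set_add_def' by blast
    then show "x \<in> saturation R M (S (Suc n) <+> M \<cdot> S n)"
      using s(1) xc unfolding saturation_def by blast
  qed
  obtain F where F: "F \<subseteq> carrier R" "finite F" "S n = Idl F"
    using finetely_gen[OF iS[of n]] by blast
  have FS: "F \<subseteq> S n" using genideal_self[OF F(1)] F(3) by auto
  obtain t where t: "t \<in> carrier R - M" "\<forall>x\<in>S n. t \<otimes> x \<in> S (Suc n) <+> M \<cdot> S n"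
    using uniform_denominator[OF M iT F(2) order_trans[OF FS Ssat]] unfolding F(3)[symmetric] by blast
  have "S n \<subseteq> S (Suc n) <+> Idl F" using le_add_ideals(2)[OF iS iS, of n "Suc n"] unfolding F(3)[symmetric] .
  \<comment> \<open>Nakayama's lemma at \<open>M\<close>: the multiplier is outside
    \<open>M\<close>, hence outside \<open>Q\<close>, and \<open>S (Suc n)\<close> is saturated at
    \<open>Q\<close>, so \<open>S n \<subseteq> S (Suc n)\<close>.\<close>
  then obtain k a where ka: "a \<in> M" "\<forall>x\<in>S n. (t [^] (k::nat) \<oplus> a) \<otimes> x \<in> S (Suc n)"
    using determinant_trick[OF M.is_ideal iS _ F(2) FS iS[of "Suc n"], of t] t by blast
  have "t [^] k \<oplus> a \<in> carrier R - M" using M.compl_add[OF M.compl_pow[OF t(1)] ka(1)] .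
  then have "t [^] k \<oplus> a \<in> carrier R - Q" using QM by auto
  then have Seq: "S n \<subseteq> S (Suc n)" using ka(2) satS ideal_subset[OF iS[of n]] by blast
  \<comment> \<open>Equality of two symbolic powers says that locally at \<open>Q\<close> the power
    \<open>?N\<close> lies in \<open>P <+> Q \<cdot> ?N\<close>. Nakayama's lemma at
    \<open>Q\<close> then provides an element outside \<open>Q\<close> that multiplies
    \<open>?N\<close> into \<open>P\<close>.\<close>
  let ?N = "ideal_pow R Q n"
  have iQN: "ideal (Q \<cdot> ?N) R" using ideal_prod_is_ideal[OF Q.is_ideal iQ] .
  have iPQN: "ideal (P <+> Q \<cdot> ?N) R" using add_ideals[OF P.is_ideal iQN] .
  have eqQ: "ideal_pow R Q (Suc n) <+> P = P <+> Q \<cdot> ?N"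
    using ideal_prod_commute[OF iQ Q.is_ideal] set_add_comm[OF ideal_subset[OF iQ[of "Suc n"]] ideal_subset[OF P.is_ideal]]
    by simp
  have "?N \<subseteq> S n"
    using le_saturation[OF Q iQP] le_add_ideals(1)[OF iQ P.is_ideal] unfolding S_def by blast
  then have Nsat: "?N \<subseteq> saturation R Q (P <+> Q \<cdot> ?N)" using Seq eqQ unfolding S_def by auto
  obtain G where G: "G \<subseteq> carrier R" "finite G" "?N = Idl G"
    using finetely_gen[OF iQ[of n]] by blast
  have GN: "G \<subseteq> ?N" using genideal_self[OF G(1)] G(3) by auto
  obtain t where t: "t \<in> carrier R - Q" "\<forall>x\<in>?N. t \<otimes> x \<in> P <+> Q \<cdot> ?N"
    using uniform_denominator[OF Q iPQN G(2) order_trans[OF GN Nsat]] unfolding G(3)[symmetric] by blast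
  have "?N \<subseteq> P <+> Idl G" using le_add_ideals(2)[OF P.is_ideal iQ, of n] unfolding G(3)[symmetric] .
  then obtain k a where ka: "a \<in> Q" "\<forall>x\<in>?N. (t [^] (k::nat) \<oplus> a) \<otimes> x \<in> P"
    using determinant_trick[OF Q.is_ideal iQ _ G(2) GN P.is_ideal, of t] t by blast
  have "t [^] k \<oplus> a \<in> carrier R - Q" using Q.compl_add[OF Q.compl_pow[OF t(1)] ka(1)] .
  then have ta: "t [^] k \<oplus> a \<in> carrier R" "t [^] k \<oplus> a \<notin> P" using PQ by auto
  have "Q \<subseteq> P"
  proof
    fix y assume y: "y \<in> Q"
    then have "(t [^] k \<oplus> a) \<otimes> y [^] n \<in> P"
      using ka(2) pow_mem_ideal_pow[OF Q.is_ideal] by blast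
    then have "y [^] n \<in> P" using P.I_prime[of "t [^] k \<oplus> a" "y [^] n"] ta Q.Icarr[OF y] by auto
    then show "y \<in> P" using P.pow_mem Q.Icarr y by blast
  qed
  then show False using PQ by auto
qed

section \<open>Chains of prime ideals with both ends prescribed\<close>

primrec prime_chain :: "('a, 'b) ring_scheme \<Rightarrow> nat \<Rightarrow> 'a set \<Rightarrow> 'a set \<Rightarrow> bool" where
  "prime_chain R 0 P Q \<longleftrightarrow> primeideal Q R \<and> P = Q"
| "prime_chain R (Suc n) P Q \<longleftrightarrow> primeideal Q R \<and> (\<exists>P'. prime_chain R n P P' \<and> P' \<subset> Q)"

lemma prime_chain_primeideal:
  "prime_chain R n P Q \<Longrightarrow> primeideal P R \<and> primeideal Q R \<and> P \<subseteq> Q"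
proof (induction n arbitrary: Q)
  case (Suc n)
  then obtain P' where "prime_chain R n P P'" "P' \<subset> Q" "primeideal Q R" by auto
  with Suc.IH[of P'] show ?case by auto
qed simp

lemma prime_chain_of_seq:
  assumes "\<And>i. i \<le> n \<Longrightarrow> primeideal (P i) R" "\<And>i. i < n \<Longrightarrow> P i \<subset> P (Suc i)"
  shows "prime_chain R n (P 0) (P n)"
  using assms
proof (induction n)
  case (Suc n)
  then have "prime_chain R n (P 0) (P n)" by simp
  moreover have "P n \<subset> P (Suc n)" "primeideal (P (Suc n)) R" using Suc.prems by auto
  ultimately show ?case by (auto simp del: psubsetE)
qed simp

text \<open>\<open>krull_principal\<close> exchanges the prime just below the top for one containing
  \<open>b\<close> and keeps the prime below that. Repeating this downwards reaches the first prime
  above \<open>P\<close>.\<close>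

lemma (in noetherian_cring) prime_chain_through:
  assumes "prime_chain R (Suc n) P Q" "b \<in> Q"
  shows "\<exists>P1. P \<subset> P1 \<and> b \<in> P1 \<and> prime_chain R n P1 Q"
  using assms
proof (induction n arbitrary: Q)
  case 0
  then show ?case by auto
next
  case (Suc n)
  then obtain P' P'' where *: "primeideal Q R" "primeideal P' R" "prime_chain R n P P''"
    "P'' \<subset> P'" "P' \<subset> Q" by auto
  obtain Q' where Q': "primeideal Q' R" "P'' \<subset> Q'" "Q' \<subset> Q" "b \<in> Q'"
    using krull_principal[of P'' P' Q b] * Suc.prems(2) prime_chain_primeideal by blast
  then have "prime_chain R (Suc n) P Q'" using * by auto
  then obtain P1 where "P \<subset> P1" "b \<in> P1" "prime_chain R n P1 Q'" using Suc.IH Q'(4) by blast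
  then show ?case using Q'(3) *(1) by auto
qed

section \<open>Regular local rings are domains\<close>

lemma (in local_ring) maximalideal_compl_Units:
  assumes "noetherian_ring R" "maximalideal M R" "x \<in> carrier R" "x \<notin> M"
  shows "x \<in> Units R"
proof (rule ccontr)
  assume "x \<notin> Units R"
  interpret noetherian_ring R by fact
  have "\<one> \<notin> PIdl x"
  proof
    assume "\<one> \<in> PIdl x"
    then obtain y where "y \<in> carrier R" "\<one> = y \<otimes> x" unfolding cgenideal_def by auto
    then show False using \<open>x \<notin> Units R\<close> assms(3) m_comm[of x y] unfolding Units_def by auto
  qed
  then have "PIdl x \<noteq> carrier R" by auto
  then obtain M' where M': "maximalideal M' R" "PIdl x \<subseteq> M'"
    using exists_maximalideal cgenideal_ideal[OF assms(3)] by blast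
  have "M' = M" using M'(1) assms(2) unique_maximal by auto
  then show False using M'(2) cgenideal_self[OF assms(3)] assms(4) by auto
qed

text \<open>Induction on the number of generators. For \<open>b\<close> in \<open>F\<close> outside
  \<open>P\<close>, let the chain pass through \<open>b\<close> right above \<open>P\<close>; by
  induction that prime is \<open>J <+> PIdl b\<close>. An element
  \<open>j \<oplus> r \<otimes> b\<close> of \<open>P\<close> has \<open>r\<close> in
  \<open>P\<close> because \<open>b\<close> is not, so
  \<open>P \<subseteq> J <+> M \<cdot> P\<close>, and Nakayama's lemma gives
  \<open>P = J\<close>.\<close>

lemma (in local_ring) prime_chain_bottom:
  assumes noeth: "noetherian_ring R" and M: "maximalideal M R"
  shows "ideal J R \<Longrightarrow> finite F \<Longrightarrow> card F \<le> k \<Longrightarrow> F \<subseteq> carrier R \<Longrightarrow> M = J <+> Idl F \<Longrightarrow> J \<subseteq> P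
    \<Longrightarrow> prime_chain R k P M \<Longrightarrow> P = J"
proof (induction k arbitrary: J F P)
  case 0
  then have "P = J <+> {\<zero>}" by (simp add: Idl_empty)
  also have "\<dots> = J" using ideal_subset[OF 0(1)] by (force simp: set_add_def')
  finally show ?case .
next
  case (Suc k)
  interpret noetherian_cring R
    using noeth is_cring by (intro noetherian_cring.intro)
  interpret M: maximalideal M R by fact
  interpret J: ideal J R by fact
  interpret P: primeideal P R using Suc.prems prime_chain_primeideal by blast
  have PM: "P \<subset> M"
    using Suc.prems(7) prime_chain_primeideal[of R k P] by auto
  have "\<not> F \<subseteq> P"
  proof
    assume "F \<subseteq> P"
    then have "J <+> Idl F \<subseteq> P"
      using add_ideals_le[OF P.is_ideal Suc.prems(6)] genideal_minimal[OF P.is_ideal] by blast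
    then show False using PM Suc.prems(5) by auto
  qed
  then obtain b where b: "b \<in> F" "b \<notin> P" by auto
  have bc: "b \<in> carrier R" and F'c: "F - {b} \<subseteq> carrier R" using b Suc.prems(4) by auto
  have ib: "ideal (PIdl b) R" by (rule cgenideal_ideal[OF bc])
  have iF: "ideal (Idl F) R" by (rule genideal_ideal[OF Suc.prems(4)])
  have bM: "b \<in> M"
    using le_add_ideals(2)[OF J.is_ideal iF] genideal_self[OF Suc.prems(4)] b(1) Suc.prems(5) by auto
  obtain P1 where P1: "P \<subset> P1" "b \<in> P1" "prime_chain R k P1 M"
    using prime_chain_through[OF Suc.prems(7) bM] by blast
  interpret P1: primeideal P1 R using P1(3) prime_chain_primeideal by blast
  let ?J = "J <+> PIdl b"
  have iJ: "ideal ?J R" using add_ideals[OF J.is_ideal ib] .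
  have "P1 = ?J"
  proof (rule Suc.IH[OF iJ _ _ F'c])
    show "finite (F - {b})" "card (F - {b}) \<le> k" using Suc.prems(2,3) b(1) by auto
    have "Idl F = Idl (F - {b}) <+> PIdl b"
      using Idl_insert[OF F'c bc] b(1) by (simp add: insert_absorb)
    also have "\<dots> = PIdl b <+> Idl (F - {b})"
      using set_add_comm ideal_subset[OF ib] ideal_subset[OF genideal_ideal[OF F'c]] by blast
    finally show "M = ?J <+> Idl (F - {b})"
      using Suc.prems(5) add.set_mult_assoc ideal_subset[OF ib] J.a_subset
        ideal_subset[OF genideal_ideal[OF F'c]] by (simp add: set_add_def)
    show "?J \<subseteq> P1"
      using add_ideals_le[OF P1.is_ideal _ cgenideal_minimal[OF P1.is_ideal P1(2)]]
        Suc.prems(6) P1(1) by blast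
  qed (rule P1(3))
  have PJ: "x \<in> J <+> M \<cdot> P" if x: "x \<in> P" for x
  proof -
    obtain j r where jr: "j \<in> J" "r \<in> carrier R" "x = j \<oplus> r \<otimes> b"
    proof -
      have "x \<in> ?J" using \<open>P1 = ?J\<close> P1(1) x by blast
      then show thesis using that by (auto simp: mem_add_PIdl)
    qed
    have jP: "j \<in> P" using jr(1) Suc.prems(6) by auto
    have "r \<otimes> b = x \<ominus> j"
      using jr bc J.Icarr[OF jr(1)] by (simp add: a_minus_def a_ac r_neg1 r_neg2)
    then have "r \<otimes> b \<in> P" using x jP by (simp add: a_minus_def)
    then have "r \<in> P" using P.I_prime[OF jr(2) bc] b(2) by auto
    then have "r \<otimes> b \<in> M \<cdot> P"
      using ideal_prod.prod[OF bM, of r P R] jr(2) bc by (simp add: m_comm)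
    then show ?thesis using jr unfolding set_add_def' by blast
  qed
  obtain G where G: "G \<subseteq> carrier R" "finite G" "P = Idl G"
    using finetely_gen[OF P.is_ideal] by blast
  have GP: "G \<subseteq> P" using genideal_self[OF G(1)] G(3) by auto
  have "P \<subseteq> J <+> Idl G" using le_add_ideals(2)[OF J.is_ideal P.is_ideal] unfolding G(3)[symmetric] .
  moreover have "\<one> \<otimes> x \<in> J <+> M \<cdot> P" if "x \<in> P" for x using PJ[OF that] P.Icarr[OF that] by simp
  \<comment> \<open>With \<open>t = \<one>\<close> the multiplier is congruent to
    \<open>\<one>\<close> modulo \<open>M\<close>, hence a unit.\<close>
  ultimately obtain n a where a: "a \<in> M" "\<And>x. x \<in> P \<Longrightarrow> (\<one> [^] (n::nat) \<oplus> a) \<otimes> x \<in> J"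
    using determinant_trick[OF M.is_ideal P.is_ideal one_closed G(2) GP J.is_ideal] by blast
  interpret Mp: primeideal M R using maximalideal_prime[OF M] .
  have u: "\<one> [^] n \<oplus> a \<in> Units R"
    using maximalideal_compl_Units[OF noeth M] Mp.compl_add[OF Mp.compl_pow[OF Mp.one_compl] a(1)]
    by auto
  have "P \<subseteq> J"
  proof
    fix x assume x: "x \<in> P"
    let ?u = "\<one> [^] n \<oplus> a"
    have "x = inv ?u \<otimes> (?u \<otimes> x)"
      using u P.Icarr[OF x] by (simp add: m_assoc[symmetric] Units_closed)
    moreover have "inv ?u \<otimes> (?u \<otimes> x) \<in> J"
      using J.I_l_closed[OF a(2)[OF x]] u by blast
    ultimately show "x \<in> J" by simp
  qed
  then show ?case using Suc.prems(6) by auto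
qed

text \<open>Some chain of primes has length \<open>card B\<close>, the number of generators of the
  maximal ideal. By \<open>prime_chain_bottom\<close> with \<open>J = {\<zero>}\<close> its lowest
  prime is zero.\<close>

lemma (in regular_local_ring) regular_local_domain: "domain R"
proof -
  obtain B where B: "B \<subseteq> carrier R" "finite B" "maximalideal (Idl B) R"
    "enat (card B) = krull_dim R" using regular_generators by blast
  let ?M = "Idl B"
  have noeth: "noetherian_ring R" by (rule noetherian_ring_axioms)
  interpret noetherian_cring R
    using noeth is_cring by (intro noetherian_cring.intro)
  interpret M: maximalideal ?M R by fact
  have pM: "primeideal ?M R" using maximalideal_prime B(3) .
  define lengths where "lengths = {n. \<exists>P. (\<forall>i\<le>n. primeideal (P i) R) \<and> (\<forall>i<n. P i \<subset> P (Suc i))}"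
  have dim: "enat (card B) = Sup (enat ` lengths)"
    unfolding B(4) krull_dim_def lengths_def by (rule arg_cong[of _ _ Sup]) auto
  have "0 \<in> lengths" unfolding lengths_def using pM by auto
  have le: "n \<le> card B" if "n \<in> lengths" for n
  proof -
    have "enat n \<le> Sup (enat ` lengths)" using that by (intro Sup_upper) auto
    then have "enat n \<le> enat (card B)" by (simp only: dim)
    then show ?thesis by simp
  qed
  \<comment> \<open>The supremum is attained because it is finite: lengths at most
    \<open>card B\<close> that avoid \<open>card B\<close> would be bounded by
    \<open>card B - 1\<close>.\<close>
  have "card B \<in> lengths"
  proof (rule ccontr)
    assume *: "card B \<notin> lengths"
    then have pos: "card B > 0" using \<open>0 \<in> lengths\<close> by (cases "card B") auto
    have "Sup (enat ` lengths) \<le> enat (card B - 1)"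
    proof (rule Sup_least)
      fix x assume "x \<in> enat ` lengths"
      then obtain n where n: "n \<in> lengths" "x = enat n" by auto
      then have "n \<le> card B" "n \<noteq> card B" using le * by auto
      then show "x \<le> enat (card B - 1)" using n by auto
    qed
    then have "enat (card B) \<le> enat (card B - 1)" by (simp only: dim)
    then show False using pos by simp
  qed
  then obtain P where P: "\<And>i. i \<le> card B \<Longrightarrow> primeideal (P i) R"
    "\<And>i. i < card B \<Longrightarrow> P i \<subset> P (Suc i)" unfolding lengths_def by auto
  \<comment> \<open>The last prime of the chain can therefore be replaced by
    \<open>?M\<close>.\<close>
  have "P (card B) \<subseteq> ?M"
  proof -
    interpret Pd: primeideal "P (card B)" R using P(1) by simp
    obtain M' where "maximalideal M' R" "P (card B) \<subseteq> M'"
      using exists_maximalideal Pd.is_ideal Pd.I_notcarr by metis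
    then show ?thesis using unique_maximal B(3) by blast
  qed
  then have "\<exists>Q. prime_chain R (card B) Q ?M"
  proof (cases "card B")
    case 0
    then show ?thesis using pM by auto
  next
    case (Suc d)
    have "prime_chain R d (P 0) (P d)"
      using P Suc by (intro prime_chain_of_seq) auto
    moreover have "P d \<subset> ?M" using P(2)[of d] Suc \<open>P (card B) \<subseteq> ?M\<close> by auto
    ultimately show ?thesis using pM Suc by auto
  qed
  then obtain Q where Q: "prime_chain R (card B) Q ?M" by blast
  interpret Q: primeideal Q R using Q prime_chain_primeideal by blast
  have "?M = {\<zero>} <+> ?M" using M.a_subset by (force simp: set_add_def')
  then have "Q = {\<zero>}"
    using prime_chain_bottom[OF noeth B(3) zeroideal B(2) order_refl B(1) _ _ Q] Q.zero_closed by auto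
  then have "primeideal {\<zero>} R" using Q.primeideal by simp
  then show ?thesis by (rule zeroprimeideal_domainI)
qed

section \<open>Reducedness of regular rings\<close>

lemma (in cring) nilpotent_eq_zero:
  assumes red: "\<And>x. x \<in> carrier R \<Longrightarrow> x \<otimes> x = \<zero> \<Longrightarrow> x = \<zero>"
    and x: "x \<in> carrier R" "x [^] (n::nat) = \<zero>"
  shows "x = \<zero>"
proof -
  \<comment> \<open>Exponents that are powers of 2 can be halved by \<open>red\<close>, and the
    power \<open>2 ^ n\<close> of \<open>x\<close> is a multiple of \<open>x [^] n\<close> because
    \<open>n < 2 ^ n\<close>.\<close>
  have *: "x [^] ((2::nat) ^ k) = \<zero> \<Longrightarrow> x = \<zero>" for k
  proof (induction k)
    case (Suc k)
    have "x [^] ((2::nat) ^ Suc k) = x [^] ((2::nat) ^ k) \<otimes> x [^] ((2::nat) ^ k)"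
      using x(1) by (simp add: nat_pow_mult mult_2)
    then show ?case using Suc red[of "x [^] ((2::nat) ^ k)"] x(1) by auto
  qed (use x in simp)
  have "x [^] ((2::nat) ^ n) = x [^] n \<otimes> x [^] (2 ^ n - n)"
    using x(1) by (simp add: nat_pow_mult less_exp less_imp_le)
  then show ?thesis using * x by simp
qed

text \<open>The annihilator of a nonzero \<open>x\<close> lies in a maximal ideal \<open>M\<close>.
  In the localization at \<open>M\<close>, a domain, the fraction \<open>x / \<one>\<close> squares
  to zero and so vanishes; hence something outside \<open>M\<close> annihilates \<open>x\<close>, a
  contradiction.\<close>

theorem (in regular_ring) regular_ring_reduced:
  assumes x: "x \<in> carrier R" "x \<otimes> x = \<zero>"
  shows "x = \<zero>"
proof (rule ccontr)
  assume "x \<noteq> \<zero>"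
  define ann where "ann = {y \<in> carrier R. x \<otimes> y \<in> {\<zero>}}"
  have "ideal ann R"
    unfolding ann_def by (rule ideal.helper_max_prime[OF zeroideal is_cring x(1)])
  moreover have "ann \<noteq> carrier R"
  proof
    assume "ann = carrier R"
    then have "\<one> \<in> ann" by simp
    then show False using \<open>x \<noteq> \<zero>\<close> x(1) unfolding ann_def by simp
  qed
  ultimately obtain M where M: "maximalideal M R" "ann \<subseteq> M" using exists_maximalideal by blast
  interpret M: primeideal M R using maximalideal_prime M(1) by blast
  define S where "S = carrier R - M"
  have S1: "\<one> \<in> S" using M.one_compl unfolding S_def .
  have Sm: "s \<otimes> t \<in> S" if "s \<in> S" "t \<in> S" for s t using M.compl_mult that unfolding S_def by blast
  have Sc: "s \<in> carrier R" if "s \<in> S" for s using that unfolding S_def by auto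
  let ?L = "localization R S"
  let ?u = "loc_frac R S x \<one>" and ?z = "loc_frac R S \<zero> \<one>"
  interpret L: regular_local_ring ?L
    using regular_localization[OF M.primeideal] unfolding S_def .
  interpret L: domain ?L by (rule L.regular_local_domain)
  have mem: "(a, b) \<in> loc_frac R S r s \<longleftrightarrow>
      a \<in> carrier R \<and> b \<in> S \<and> (\<exists>t\<in>S. t \<otimes> (b \<otimes> r) = t \<otimes> (s \<otimes> a))" for a b r s
    unfolding loc_frac_def by auto
  \<comment> \<open>Multiplication in \<open>localization\<close> is a union over all pairs of
    representatives, so every pair must be shown to give the zero fraction. The reason is that
    \<open>t \<otimes> t'\<close> annihilates \<open>r \<otimes> r'\<close>.\<close>
  have uu: "loc_frac R S (r \<otimes> r') (s \<otimes> s') = ?z" if rs: "(r, s) \<in> ?u" "(r', s') \<in> ?u" for r s r' s'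
  proof -
    obtain t where t: "t \<in> S" "t \<otimes> (s \<otimes> x) = t \<otimes> (\<one> \<otimes> r)" using rs(1) mem by auto
    obtain t' where t': "t' \<in> S" "t' \<otimes> (s' \<otimes> x) = t' \<otimes> (\<one> \<otimes> r')" using rs(2) mem by auto
    have c: "r \<in> carrier R" "r' \<in> carrier R" "s \<in> S" "s' \<in> S"
      using rs mem by auto
    note cc = c(1,2) Sc[OF c(3)] Sc[OF c(4)] Sc[OF t(1)] Sc[OF t'(1)] x(1)
    have "(t \<otimes> t') \<otimes> (r \<otimes> r') = (t \<otimes> (\<one> \<otimes> r)) \<otimes> (t' \<otimes> (\<one> \<otimes> r'))"
      using cc by (simp add: m_ac)
    also have "\<dots> = (t \<otimes> (s \<otimes> x)) \<otimes> (t' \<otimes> (s' \<otimes> x))" by (simp only: t t')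
    also have "\<dots> = (t \<otimes> s \<otimes> t' \<otimes> s') \<otimes> (x \<otimes> x)"
      using cc by (simp add: m_ac)
    finally have 0: "(t \<otimes> t') \<otimes> (r \<otimes> r') = \<zero>" using x cc by simp
    have "(\<exists>w\<in>S. w \<otimes> (b \<otimes> (r \<otimes> r')) = w \<otimes> (s \<otimes> s' \<otimes> a)) \<longleftrightarrow>
        (\<exists>w\<in>S. w \<otimes> (b \<otimes> \<zero>) = w \<otimes> (\<one> \<otimes> a))" if ab: "a \<in> carrier R" "b \<in> S" for a b
    proof -
      note bc = ab(1) Sc[OF ab(2)]
      show ?thesis
      proof
        assume "\<exists>w\<in>S. w \<otimes> (b \<otimes> (r \<otimes> r')) = w \<otimes> (s \<otimes> s' \<otimes> a)"
        then obtain w where w: "w \<in> S" "w \<otimes> (b \<otimes> (r \<otimes> r')) = w \<otimes> (s \<otimes> s' \<otimes> a)" by blast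
        note wc = Sc[OF w(1)]
        have "(t \<otimes> t' \<otimes> w \<otimes> (s \<otimes> s')) \<otimes> a = (t \<otimes> t') \<otimes> (w \<otimes> (s \<otimes> s' \<otimes> a))"
          using cc bc wc by (simp add: m_ac)
        also have "\<dots> = (t \<otimes> t') \<otimes> (w \<otimes> (b \<otimes> (r \<otimes> r')))" by (simp only: w)
        also have "\<dots> = (w \<otimes> b) \<otimes> ((t \<otimes> t') \<otimes> (r \<otimes> r'))"
          using cc bc wc by (simp add: m_ac)
        also have "\<dots> = \<zero>" using 0 bc wc by simp
        finally have "(t \<otimes> t' \<otimes> w \<otimes> (s \<otimes> s')) \<otimes> (b \<otimes> \<zero>) = (t \<otimes> t' \<otimes> w \<otimes> (s \<otimes> s')) \<otimes> (\<one> \<otimes> a)"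
          using cc bc wc by simp
        moreover have "t \<otimes> t' \<otimes> w \<otimes> (s \<otimes> s') \<in> S" by (intro Sm t(1) t'(1) w(1) c(3,4))
        ultimately show "\<exists>w\<in>S. w \<otimes> (b \<otimes> \<zero>) = w \<otimes> (\<one> \<otimes> a)" by (rule bexI)
      next
        assume "\<exists>w\<in>S. w \<otimes> (b \<otimes> \<zero>) = w \<otimes> (\<one> \<otimes> a)"
        then obtain w where w: "w \<in> S" "w \<otimes> (b \<otimes> \<zero>) = w \<otimes> (\<one> \<otimes> a)" by blast
        note wc = Sc[OF w(1)]
        have wa: "w \<otimes> a = \<zero>" using w(2) bc wc by simp
        have "(w \<otimes> (t \<otimes> t')) \<otimes> (b \<otimes> (r \<otimes> r')) = (w \<otimes> b) \<otimes> ((t \<otimes> t') \<otimes> (r \<otimes> r'))"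
          using cc bc wc by (simp add: m_ac)
        also have "\<dots> = (t \<otimes> t' \<otimes> (s \<otimes> s')) \<otimes> (w \<otimes> a)" using 0 wa cc bc wc by simp
        also have "\<dots> = (w \<otimes> (t \<otimes> t')) \<otimes> (s \<otimes> s' \<otimes> a)"
          using cc bc wc by (simp add: m_ac)
        finally show "\<exists>w\<in>S. w \<otimes> (b \<otimes> (r \<otimes> r')) = w \<otimes> (s \<otimes> s' \<otimes> a)"
          by (rule bexI) (intro Sm w(1) t(1) t'(1))
      qed
    qed
    then have "(a, b) \<in> loc_frac R S (r \<otimes> r') (s \<otimes> s') \<longleftrightarrow> (a, b) \<in> ?z" for a b
      unfolding mem by blast
    then show ?thesis by (intro equalityI subrelI) blast+
  qed
  have xu: "(x, \<one>) \<in> ?u" using x(1) S1 by (auto simp: mem)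
  have "?u \<otimes>\<^bsub>?L\<^esub> ?u = (\<Union>(r, s)\<in>?u. \<Union>(r', s')\<in>?u. loc_frac R S (r \<otimes> r') (s \<otimes> s'))"
    by (simp add: localization_def)
  also have "\<dots> = ?z"
  proof (rule SUP_eq_const)
    show ne: "?u \<noteq> {}" using xu by (rule ex_in_conv[THEN iffD1, OF exI])
    fix w assume w: "w \<in> ?u"
    obtain r s where rs: "w = (r, s)" by (cases w)
    have "(\<Union>(r', s')\<in>?u. loc_frac R S (r \<otimes> r') (s \<otimes> s')) = ?z"
    proof (rule SUP_eq_const[OF ne])
      fix w' assume w': "w' \<in> ?u"
      obtain r' s' where "w' = (r', s')" by (cases w')
      then show "(case w' of (r', s') \<Rightarrow> loc_frac R S (r \<otimes> r') (s \<otimes> s')) = ?z"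
        using uu[of r s r' s'] w w' rs by simp
    qed
    then show "(case w of (r, s) \<Rightarrow> \<Union>(r', s')\<in>?u. loc_frac R S (r \<otimes> r') (s \<otimes> s')) = ?z"
      using rs by simp
  qed
  also have "\<dots> = \<zero>\<^bsub>?L\<^esub>" by (simp add: localization_def)
  finally have "?u \<otimes>\<^bsub>?L\<^esub> ?u = \<zero>\<^bsub>?L\<^esub>" .
  moreover have "?u \<in> carrier ?L" using x(1) S1 by (auto simp: localization_def)
  ultimately have "?u = ?z" using L.integral[of ?u ?u] by (simp add: localization_def)
  then obtain t where "t \<in> S" "t \<otimes> (\<one> \<otimes> \<zero>) = t \<otimes> (\<one> \<otimes> x)" using xu mem by auto
  then have "t \<in> ann" using x(1) Sc[of t] unfolding ann_def by (auto simp: m_comm)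
  then show False using M(2) \<open>t \<in> S\<close> unfolding S_def by auto
qed

section \<open>The Frobenius endomorphism\<close>

lemma (in cring) binomial_theorem:
  assumes x: "x \<in> carrier R" and y: "y \<in> carrier R"
  shows "(x \<oplus> y) [^] n = (\<Oplus>k\<in>{..n}. add_pow R (n choose k) (x [^] k \<otimes> y [^] (n - k)))"
proof (induction n)
  case 0
  then show ?case by simp
next
  case (Suc n)
  let ?b = "\<lambda>n k. add_pow R (n choose k) (x [^] k \<otimes> y [^] (n - k))"
  let ?u = "\<lambda>k. add_pow R (n choose k) (x [^] Suc k \<otimes> y [^] (n - k))"
  let ?v = "\<lambda>k. add_pow R (n choose k) (x [^] k \<otimes> y [^] (Suc n - k))"
  have b: "?b n k \<in> carrier R" and u: "?u k \<in> carrier R" and v: "?v k \<in> carrier R" for n k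
    using x y by auto
  have fb: "?b n \<in> A \<rightarrow> carrier R" and fu: "?u \<in> A \<rightarrow> carrier R" and fv: "?v \<in> A \<rightarrow> carrier R" for n A
    using x y by auto
  have "(x \<oplus> y) [^] Suc n = x \<otimes> (\<Oplus>k\<in>{..n}. ?b n k) \<oplus> y \<otimes> (\<Oplus>k\<in>{..n}. ?b n k)"
    using Suc x y fb by (simp add: m_comm[of _ "x \<oplus> y"] l_distr)
  also have "x \<otimes> (\<Oplus>k\<in>{..n}. ?b n k) = (\<Oplus>k\<in>{..n}. x \<otimes> ?b n k)"
    by (rule finsum_rdistr) (use x fb in auto)
  also have "\<dots> = (\<Oplus>k\<in>{..n}. ?u k)"
    by (rule add.finprod_cong') (use x y in \<open>auto simp: add_pow_rdistr m_ac\<close>)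
  also have "y \<otimes> (\<Oplus>k\<in>{..n}. ?b n k) = (\<Oplus>k\<in>{..n}. y \<otimes> ?b n k)"
    by (rule finsum_rdistr) (use y fb in auto)
  also have "\<dots> = (\<Oplus>k\<in>{..n}. ?v k)"
    by (rule add.finprod_cong')
      (use x y in \<open>auto simp: add_pow_rdistr Suc_diff_le m_ac\<close>)
  \<comment> \<open>The new summand has coefficient \<open>n choose Suc n\<close>, which is 0. After
    splitting off \<open>?v 0\<close>, the shifted sum matches the other one index by index for
    Pascal's rule.\<close>
  also have "(\<Oplus>k\<in>{..n}. ?v k) = (\<Oplus>k\<in>{..Suc n}. ?v k)"
    using fv x y by (simp add: finsum_Suc binomial_eq_0)
  also have "\<dots> = (\<Oplus>k\<in>{..n}. ?v (Suc k)) \<oplus> ?v 0"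
    using fv by (intro finsum_Suc2) auto
  also have "(\<Oplus>k\<in>{..n}. ?u k) \<oplus> ((\<Oplus>k\<in>{..n}. ?v (Suc k)) \<oplus> ?v 0)
      = (\<Oplus>k\<in>{..n}. ?u k \<oplus> ?v (Suc k)) \<oplus> ?v 0"
    using fu fv u v x y by (subst finsum_addf) (auto simp: a_assoc)
  also have "(\<Oplus>k\<in>{..n}. ?u k \<oplus> ?v (Suc k)) = (\<Oplus>k\<in>{..n}. ?b (Suc n) (Suc k))"
    by (rule add.finprod_cong') (use x y in \<open>auto simp: add.nat_pow_mult\<close>)
  also have "\<dots> \<oplus> ?v 0 = (\<Oplus>k\<in>{..Suc n}. ?b (Suc n) k)"
    using fb by (subst finsum_Suc2) auto
  finally show ?case .
qed

lemma (in cring) frobenius_add: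
  assumes p: "Factorial_Ring.prime (p::nat)" and char: "\<And>x. x \<in> carrier R \<Longrightarrow> add_pow R p x = \<zero>"
    and x: "x \<in> carrier R" and y: "y \<in> carrier R"
  shows "(x \<oplus> y) [^] p = x [^] p \<oplus> y [^] p"
proof -
  \<comment> \<open>This form separates the end terms \<open>0\<close> and \<open>p\<close> of the
    binomial sum from the inner indices \<open>Suc k\<close> with \<open>k \<le> l\<close>, whose
    coefficients \<open>p\<close> divides.\<close>
  obtain l where l: "p = Suc (Suc l)"
    using prime_ge_2_nat[OF p] by (metis Suc_le_D numeral_2_eq_2 Suc_le_mono)
  let ?b = "\<lambda>k. add_pow R (p choose k) (x [^] k \<otimes> y [^] (p - k))"
  have fb: "?b \<in> A \<rightarrow> carrier R" for A using x y by auto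
  have mid: "?b (Suc k) = \<zero>" if "k \<in> {..l}" for k
  proof -
    have "p dvd p choose Suc k"
      using that l p by (intro dvd_choose_prime) auto
    then obtain m where "p choose Suc k = p * m" by (auto elim: dvdE)
    moreover have z: "x [^] Suc k \<otimes> y [^] (p - Suc k) \<in> carrier R" using x y by simp
    ultimately show ?thesis
      using char[OF z] add.nat_pow_pow[OF z, of m p] by (simp add: mult.commute)
  qed
  have "(x \<oplus> y) [^] p = (\<Oplus>k\<in>{..Suc (Suc l)}. ?b k)"
    using binomial_theorem[OF x y, of p] by (simp only: l)
  also have "\<dots> = ?b p \<oplus> (\<Oplus>k\<in>{..Suc l}. ?b k)"
    using finsum_Suc[of ?b "Suc l"] fb by (simp add: l)
  also have "(\<Oplus>k\<in>{..Suc l}. ?b k) = (\<Oplus>k\<in>{..l}. ?b (Suc k)) \<oplus> ?b 0"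
    using fb by (intro finsum_Suc2) auto
  also have "(\<Oplus>k\<in>{..l}. ?b (Suc k)) = (\<Oplus>k\<in>{..l}. \<zero>)"
    by (rule add.finprod_cong') (use mid in auto)
  finally show ?thesis using x y by simp
qed

text \<open>The composite of the projection from the integers with the embedding sends
  \<open>int p\<close> both to \<open>\<zero>\<close> and to the \<open>p\<close>-fold sum of
  \<open>\<one>\<close>.\<close>

lemma (in cring) char_contains_prime_field:
  assumes "contains_prime_field R p" "x \<in> carrier R"
  shows "add_pow R p x = \<zero>"
proof -
  let ?I = "Idl\<^bsub>\<Z>\<^esub> {int p}"
  obtain h where h: "h \<in> ring_hom (ZFact (int p)) R"
    using assms(1) unfolding contains_prime_field_def by blast
  interpret Z: ideal ?I \<Z> by (rule int.genideal_ideal) simp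
  have q: "(\<lambda>a. ?I +>\<^bsub>\<Z>\<^esub> a) \<in> ring_hom \<Z> (ZFact (int p))"
    unfolding ZFact_def by (rule Z.rcos_ring_hom)
  define g where "g a = h (?I +>\<^bsub>\<Z>\<^esub> a)" for a
  have g: "g \<in> ring_hom \<Z> R"
    unfolding g_def using ring_hom_trans[OF q h] by (simp add: comp_def)
  interpret g: ring_hom_ring \<Z> R g
    using g int.ring_axioms ring_axioms by (intro ring_hom_ringI2)
  have gn: "g (int n) = add_pow R n \<one>" for n
  proof (induction n)
    case 0
    show ?case using g.hom_zero by simp
  next
    case (Suc n)
    have "g (int (Suc n)) = g (int n) \<oplus> g 1"
      using g.hom_add[of "int n" 1] by (simp add: add.commute)
    then show ?case using Suc g.hom_one by simp
  qed
  have "int p \<in> ?I" using int.genideal_self'[of "int p"] by simp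
  then have "?I +>\<^bsub>\<Z>\<^esub> int p = ?I +>\<^bsub>\<Z>\<^esub> 0"
    using int.a_rcos_zero[OF Z.is_ideal] Z.zero_closed by simp
  then have "g (int p) = \<zero>" using g.hom_zero unfolding g_def by simp
  then have "add_pow R p \<one> = \<zero>" using gn by simp
  then show ?thesis using add_pow_ldistr[of \<one> x p] assms(2) by simp
qed

section \<open>Frobenius powers of ideals\<close>

lemma (in cring) frob_power_ideal: "J \<subseteq> carrier R \<Longrightarrow> ideal (frob_power R J q) R"
  unfolding frob_power_def by (rule genideal_ideal) auto

lemma (in cring) pow_mem_frob_power: "J \<subseteq> carrier R \<Longrightarrow> u \<in> J \<Longrightarrow> u [^] q \<in> frob_power R J q"
  unfolding frob_power_def by (rule subsetD[OF genideal_self]) auto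

lemma (in cring) frob_power_subset_iff:
  assumes "ideal K R" "J \<subseteq> carrier R"
  shows "frob_power R J q \<subseteq> K \<longleftrightarrow> (\<forall>u\<in>J. u [^] q \<in> K)"
  unfolding frob_power_def using assms(2) by (subst Idl_subset_ideal[OF assms(1)]) auto

lemma (in cring) frob_power_1: "ideal J R \<Longrightarrow> frob_power R J (Suc 0) = J"
proof
  assume J: "ideal J R"
  have Jc: "J \<subseteq> carrier R" by (rule ideal_subset[OF J])
  show "frob_power R J (Suc 0) \<subseteq> J" using Jc by (subst frob_power_subset_iff[OF J Jc]) auto
  show "J \<subseteq> frob_power R J (Suc 0)"
  proof
    fix u assume u: "u \<in> J"
    then have "u \<in> carrier R" using Jc by auto
    then show "u \<in> frob_power R J (Suc 0)"
      using pow_mem_frob_power[OF Jc u, of "Suc 0"] by simp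
  qed
qed

lemma (in cring) pow_mem_ideal: "ideal J R \<Longrightarrow> x \<in> J \<Longrightarrow> 0 < q \<Longrightarrow> x [^] (q::nat) \<in> J"
  using ideal.I_l_closed[of J R x "x [^] (q - 1)"] ideal.Icarr[of J R x] by (cases q) auto

lemma (in cring) frob_power_subset: "ideal J R \<Longrightarrow> 0 < q \<Longrightarrow> frob_power R J q \<subseteq> J"
  using pow_mem_ideal[of J _ q] by (subst frob_power_subset_iff) (auto simp: ideal_subset)

definition colon_ideal :: "('a, 'b) ring_scheme \<Rightarrow> 'a set \<Rightarrow> 'a \<Rightarrow> 'a set" where
  "colon_ideal R C x = {y \<in> carrier R. x \<otimes>\<^bsub>R\<^esub> y \<in> C}"

lemma (in cring) colon_ideal_ideal: "ideal C R \<Longrightarrow> x \<in> carrier R \<Longrightarrow> ideal (colon_ideal R C x) R"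
  unfolding colon_ideal_def by (rule ideal.helper_max_prime[OF _ is_cring])

section \<open>Coordinates over the subring of \<open>p\<close>-th powers\<close>

locale frobenius_free = noetherian_cring R for R (structure) +
  fixes p :: nat and B :: "'a set"
  assumes prime_p: "Factorial_Ring.prime p"
    and char_p: "x \<in> carrier R \<Longrightarrow> add_pow R p x = \<zero>"
    and reduced: "x \<in> carrier R \<Longrightarrow> x \<otimes> x = \<zero> \<Longrightarrow> x = \<zero>"
    and basis_carrier: "B \<subseteq> carrier R"
    and finite_basis: "finite B"
    and basis: "x \<in> carrier R \<Longrightarrow>
      \<exists>!c. c \<in> B \<rightarrow>\<^sub>E power_subring R p \<and> x = (\<Oplus>b\<in>B. c b \<otimes> b)"
begin

lemma p_pos: "0 < p"
  using prime_p by (rule prime_gt_0_nat)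

lemma zero_pow_p [simp]: "\<zero> [^] p = \<zero>"
  using p_pos by (simp add: nat_pow_zero)

lemma frob_add: "x \<in> carrier R \<Longrightarrow> y \<in> carrier R \<Longrightarrow> (x \<oplus> y) [^] p = x [^] p \<oplus> y [^] p"
  using frobenius_add[OF prime_p char_p] .

lemma frob_inj:
  assumes x: "x \<in> carrier R" and y: "y \<in> carrier R" and eq: "x [^] p = y [^] p"
  shows "x = y"
proof -
  \<comment> \<open>Keeping \<open>(\<ominus> y) [^] p\<close> as it stands and applying additivity
    once more avoids a case split on the parity of \<open>p\<close>. Reducedness then turns a
    vanishing \<open>p\<close>-th power into a vanishing difference.\<close>
  have "(x \<ominus> y) [^] p = y [^] p \<oplus> (\<ominus> y) [^] p"
    using x y by (simp add: a_minus_def frob_add eq)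
  also have "\<dots> = (y \<oplus> \<ominus> y) [^] p" using y by (simp add: frob_add)
  also have "\<dots> = \<zero>" using y by (simp add: r_neg)
  finally have "x \<ominus> y = \<zero>" using nilpotent_eq_zero[OF reduced] x y by auto
  then show ?thesis using x y by simp
qed

abbreviation comb :: "('a \<Rightarrow> 'a) \<Rightarrow> 'a" where
  "comb f \<equiv> \<Oplus>b\<in>B. f b [^] p \<otimes> b"

text \<open>Coordinates are the \<open>p\<close>-th roots of the coefficients over the subring.
  Injectivity of Frobenius makes them unique on \<open>B\<close>; values outside \<open>B\<close>
  are arbitrary.\<close>

definition coord :: "'a \<Rightarrow> 'a \<Rightarrow> 'a" where
  "coord x = (SOME f. f \<in> B \<rightarrow> carrier R \<and> x = comb f)"

lemma comb_term: "f \<in> B \<rightarrow> carrier R \<Longrightarrow> b \<in> B \<Longrightarrow> f b [^] p \<otimes> b \<in> carrier R"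
  using basis_carrier by auto

lemma comb_closed: "f \<in> B \<rightarrow> carrier R \<Longrightarrow> comb f \<in> carrier R"
  using comb_term by (intro finsum_closed) auto

lemma coord_comb:
  assumes "x \<in> carrier R"
  shows "coord x \<in> B \<rightarrow> carrier R \<and> x = comb (coord x)"
proof -
  obtain c where c: "c \<in> B \<rightarrow>\<^sub>E power_subring R p" "x = (\<Oplus>b\<in>B. c b \<otimes> b)"
    using basis[OF assms] by blast
  have "\<forall>b\<in>B. \<exists>a. a \<in> carrier R \<and> c b = a [^] p"
    using c(1) unfolding power_subring_def by (auto simp: PiE_iff)
  then obtain f where f: "\<And>b. b \<in> B \<Longrightarrow> f b \<in> carrier R \<and> c b = f b [^] p" by metis
  have fB: "f \<in> B \<rightarrow> carrier R" using f by auto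
  have "x = comb f"
    unfolding c(2) by (rule add.finprod_cong') (use f comb_term[OF fB] in auto)
  then have "f \<in> B \<rightarrow> carrier R \<and> x = comb f" using fB by simp
  then show ?thesis
    unfolding coord_def by (rule someI[where P = "\<lambda>f. f \<in> B \<rightarrow> carrier R \<and> x = comb f"])
qed

lemma coord_closed [simp]: "x \<in> carrier R \<Longrightarrow> b \<in> B \<Longrightarrow> coord x b \<in> carrier R"
  using coord_comb by auto

lemma coord_unique:
  assumes f: "f \<in> B \<rightarrow> carrier R" and b: "b \<in> B"
  shows "coord (comb f) b = f b"
proof -
  let ?x = "comb f"
  \<comment> \<open>Uniqueness in \<open>basis\<close> concerns functions that are
    \<open>undefined\<close> outside \<open>B\<close>, so the coefficients are restricted to
    \<open>B\<close> before they are compared.\<close>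
  let ?c = "\<lambda>f. \<lambda>b\<in>B. f b [^] p"
  have xc: "?x \<in> carrier R" using comb_closed f .
  have c: "?c h \<in> B \<rightarrow>\<^sub>E power_subring R p \<and> comb h = (\<Oplus>b\<in>B. ?c h b \<otimes> b)"
    if h: "h \<in> B \<rightarrow> carrier R" for h
  proof
    show "?c h \<in> B \<rightarrow>\<^sub>E power_subring R p" using h unfolding power_subring_def by auto
    show "comb h = (\<Oplus>b\<in>B. ?c h b \<otimes> b)"
      by (rule add.finprod_cong') (use comb_term[OF h] in auto)
  qed
  have g: "coord ?x \<in> B \<rightarrow> carrier R" "?x = comb (coord ?x)" using coord_comb[OF xc] by auto
  obtain c0 where c0: "\<And>c. c \<in> B \<rightarrow>\<^sub>E power_subring R p \<and> ?x = (\<Oplus>b\<in>B. c b \<otimes> b) \<Longrightarrow> c = c0"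
    using basis[OF xc] by (elim ex1E) blast
  have "?c (coord ?x) = c0"
    by (rule c0) (use c[OF g(1)] in \<open>simp only: g(2)[symmetric] simp_thms\<close>)
  moreover have "?c f = c0" by (rule c0[OF c[OF f]])
  ultimately have "?c (coord ?x) b = ?c f b" by simp
  then have "coord ?x b [^] p = f b [^] p" using b by simp
  then show ?thesis using frob_inj g(1) f b by blast
qed

lemma coord_eqI: "f \<in> B \<rightarrow> carrier R \<Longrightarrow> x = comb f \<Longrightarrow> b \<in> B \<Longrightarrow> coord x b = f b"
  using coord_unique by simp

lemma coord_add:
  assumes x: "x \<in> carrier R" and y: "y \<in> carrier R" and b: "b \<in> B"
  shows "coord (x \<oplus> y) b = coord x b \<oplus> coord y b"
proof (rule coord_eqI[OF _ _ b])
  note cx = coord_comb[OF x] and cy = coord_comb[OF y]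
  have "x \<oplus> y = comb (coord x) \<oplus> comb (coord y)" using cx cy by simp
  also have "\<dots> = (\<Oplus>b\<in>B. coord x b [^] p \<otimes> b \<oplus> coord y b [^] p \<otimes> b)"
    using comb_term cx cy by (intro finsum_addf[symmetric]) auto
  also have "\<dots> = comb (\<lambda>b. coord x b \<oplus> coord y b)"
    by (rule add.finprod_cong') (use x y basis_carrier in \<open>auto simp: frob_add l_distr subsetD\<close>)
  finally show "x \<oplus> y = comb (\<lambda>b. coord x b \<oplus> coord y b)" .
qed (use x y in auto)

lemma coord_pow_mult:
  assumes x: "x \<in> carrier R" and y: "y \<in> carrier R" and b: "b \<in> B"
  shows "coord (x [^] p \<otimes> y) b = x \<otimes> coord y b"
proof (rule coord_eqI[OF _ _ b])
  note cy = coord_comb[OF y]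
  have "x [^] p \<otimes> y = x [^] p \<otimes> comb (coord y)" using cy by simp
  also have "\<dots> = (\<Oplus>b\<in>B. x [^] p \<otimes> (coord y b [^] p \<otimes> b))"
    using comb_term cy x finite_basis by (intro finsum_rdistr) auto
  also have "\<dots> = comb (\<lambda>b. x \<otimes> coord y b)"
    by (rule add.finprod_cong')
      (use x y basis_carrier in \<open>auto simp: nat_pow_distrib m_assoc subsetD\<close>)
  finally show "x [^] p \<otimes> y = comb (\<lambda>b. x \<otimes> coord y b)" .
qed (use x y in auto)

lemma coord_zero: "b \<in> B \<Longrightarrow> coord \<zero> b = \<zero>"
  using coord_pow_mult[of \<zero> \<zero> b] by simp

lemma coord_basis:
  assumes x: "x \<in> carrier R" and u: "u \<in> B" and b: "b \<in> B"
  shows "coord (x [^] p \<otimes> u) b = (if b = u then x else \<zero>)"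
proof (rule coord_eqI[OF _ _ b])
  have "comb (\<lambda>b. if b = u then x else \<zero>) = (\<Oplus>b\<in>B. if u = b then x [^] p \<otimes> b else \<zero>)"
    by (rule add.finprod_cong') (use x basis_carrier in \<open>auto simp: subsetD\<close>)
  also have "\<dots> = x [^] p \<otimes> u"
    using add.finprod_singleton[OF u finite_basis, of "\<lambda>b. x [^] p \<otimes> b"] x basis_carrier by auto
  finally show "x [^] p \<otimes> u = comb (\<lambda>b. if b = u then x else \<zero>)" by simp
qed (use x in auto)

lemma finsum_mem_ideal:
  assumes "ideal J R" "finite A" "\<And>a. a \<in> A \<Longrightarrow> f a \<in> J"
  shows "(\<Oplus>a\<in>A. f a) \<in> J"
proof -
  interpret J: ideal J R by fact
  show ?thesis using assms(2,3)
  proof (induction A)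
    case (insert a A)
    have "f \<in> A \<rightarrow> carrier R" "f a \<in> carrier R" using insert J.Icarr by auto
    then show ?case using insert by simp
  qed simp
qed

text \<open>The elements with all coordinates in \<open>J\<close> form an ideal \<open>T\<close>:
  expanding \<open>x\<close> turns \<open>r \<otimes> x\<close> into a sum of terms
  \<open>coord x b [^] p \<otimes> (r \<otimes> b)\<close>, whose coordinates are multiples of
  \<open>coord x b\<close>. It contains the \<open>p\<close>-th powers of elements of
  \<open>J\<close>; the converse is the basis expansion.\<close>

lemma frob_power_iff:
  assumes J: "ideal J R"
  shows "x \<in> frob_power R J p \<longleftrightarrow> x \<in> carrier R \<and> (\<forall>b\<in>B. coord x b \<in> J)"
proof
  interpret J: ideal J R by fact
  define T where "T = {x \<in> carrier R. \<forall>b\<in>B. coord x b \<in> J}"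
  have Tadd: "x \<oplus> y \<in> T" if "x \<in> T" "y \<in> T" for x y
    using that unfolding T_def by (auto simp: coord_add)
  have Tpow: "j [^] p \<otimes> y \<in> T" if "j \<in> J" "y \<in> carrier R" for j y
    using that J.Icarr[of j] J.I_r_closed[of j] unfolding T_def by (auto simp: coord_pow_mult)
  have T0: "\<zero> \<in> T" unfolding T_def by (auto simp: coord_zero)
  have Tc: "T \<subseteq> carrier R" unfolding T_def by auto
  have Tsum: "(\<Oplus>a\<in>A. f a) \<in> T" if "finite A" "\<And>a. a \<in> A \<Longrightarrow> f a \<in> T" for f and A :: "'a set"
    using that
  proof (induction A)
    case (insert a A)
    have "f \<in> A \<rightarrow> carrier R" "f a \<in> carrier R" using insert Tc by auto
    then show ?case using insert Tadd by simp
  qed (use T0 in simp)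
  have "ideal T R"
  proof (rule ideal_criterion[OF Tc T0 Tadd])
    fix r x assume r: "r \<in> carrier R" and x: "x \<in> T"
    then have xc: "x \<in> carrier R" and xJ: "\<And>b. b \<in> B \<Longrightarrow> coord x b \<in> J" unfolding T_def by auto
    note cx = coord_comb[OF xc]
    have "r \<otimes> x = r \<otimes> comb (coord x)" using cx by simp
    also have "\<dots> = (\<Oplus>b\<in>B. r \<otimes> (coord x b [^] p \<otimes> b))"
      using comb_term cx r finite_basis by (intro finsum_rdistr) auto
    also have "\<dots> \<in> T"
    proof (rule Tsum[OF finite_basis])
      fix b assume b: "b \<in> B"
      then have bc: "b \<in> carrier R" using basis_carrier by auto
      have "r \<otimes> (coord x b [^] p \<otimes> b) = coord x b [^] p \<otimes> (r \<otimes> b)"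
        using r bc xc b by (simp add: m_lcomm)
      then show "r \<otimes> (coord x b [^] p \<otimes> b) \<in> T" using Tpow[OF xJ[OF b]] r bc by simp
    qed
    finally show "r \<otimes> x \<in> T" .
  qed
  moreover have "u [^] p \<in> T" if "u \<in> J" for u using Tpow[OF that one_closed] J.Icarr[OF that] by simp
  ultimately have "frob_power R J p \<subseteq> T"
    by (subst frob_power_subset_iff) (auto simp: ideal_subset[OF J])
  then show "x \<in> carrier R \<and> (\<forall>b\<in>B. coord x b \<in> J)" if "x \<in> frob_power R J p"
    using that unfolding T_def by auto
next
  have i: "ideal (frob_power R J p) R" by (rule frob_power_ideal[OF ideal_subset[OF J]])
  assume x: "x \<in> carrier R \<and> (\<forall>b\<in>B. coord x b \<in> J)"
  have "comb (coord x) \<in> frob_power R J p"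
  proof (rule finsum_mem_ideal[OF i finite_basis])
    fix b assume "b \<in> B"
    then show "coord x b [^] p \<otimes> b \<in> frob_power R J p"
      using ideal.I_r_closed[OF i pow_mem_frob_power[OF ideal_subset[OF J]]] x basis_carrier by auto
  qed
  then show "x \<in> frob_power R J p" using coord_comb[of x] x by simp
qed

section \<open>The root operator and its iterates\<close>

definition root :: "'a set \<Rightarrow> 'a set" where
  "root K = Idl {coord x b | x b. x \<in> K \<and> b \<in> B}"

lemma root_ideal: "K \<subseteq> carrier R \<Longrightarrow> ideal (root K) R"
  unfolding root_def by (rule genideal_ideal) auto

lemma root_subset_iff:
  assumes "K \<subseteq> carrier R" "ideal J R"
  shows "root K \<subseteq> J \<longleftrightarrow> K \<subseteq> frob_power R J p"
proof -
  have "{coord x b | x b. x \<in> K \<and> b \<in> B} \<subseteq> carrier R" using assms(1) by auto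
  then have "root K \<subseteq> J \<longleftrightarrow> {coord x b | x b. x \<in> K \<and> b \<in> B} \<subseteq> J"
    unfolding root_def by (rule Idl_subset_ideal[OF assms(2)])
  also have "\<dots> \<longleftrightarrow> (\<forall>x\<in>K. \<forall>b\<in>B. coord x b \<in> J)" by blast
  also have "\<dots> \<longleftrightarrow> K \<subseteq> frob_power R J p"
    using assms(1) unfolding subset_iff frob_power_iff[OF assms(2)] by blast
  finally show ?thesis .
qed

lemma frob_power_frob_power:
  assumes "ideal J R"
  shows "frob_power R (frob_power R J q) p = frob_power R J (q * p)"
proof
  have Jc: "J \<subseteq> carrier R" by (rule ideal_subset[OF assms])
  let ?K = "frob_power R J (q * p)"
  have K: "ideal ?K R" by (rule frob_power_ideal[OF Jc])
  interpret K: ideal ?K R by (rule K)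
  have iq: "ideal (frob_power R J q) R" by (rule frob_power_ideal[OF Jc])
  have pp: "(u [^] q) [^] p = u [^] (q * p)" if "u \<in> carrier R" for u
    using that by (rule nat_pow_pow)
  \<comment> \<open>By additivity of Frobenius the preimage of \<open>?K\<close> under it is an
    ideal, so only the generators \<open>u [^] q\<close> have to be tested.\<close>
  have "ideal {y \<in> carrier R. y [^] p \<in> ?K} R"
    by (rule ideal_criterion) (auto simp: frob_add nat_pow_distrib K.I_l_closed)
  then have "frob_power R J q \<subseteq> {y \<in> carrier R. y [^] p \<in> ?K}"
    using pow_mem_frob_power[OF Jc, of _ "q * p"] Jc pp by (subst frob_power_subset_iff) auto
  then show "frob_power R (frob_power R J q) p \<subseteq> ?K"
    by (subst frob_power_subset_iff[OF K ideal_subset[OF iq]]) auto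
  show "?K \<subseteq> frob_power R (frob_power R J q) p"
  proof (subst frob_power_subset_iff[OF frob_power_ideal[OF ideal_subset[OF iq]] Jc], intro ballI)
    fix u assume "u \<in> J"
    then have "(u [^] q) [^] p \<in> frob_power R (frob_power R J q) p"
      using pow_mem_frob_power[OF ideal_subset[OF iq]] pow_mem_frob_power[OF Jc] by blast
    then show "u [^] (q * p) \<in> frob_power R (frob_power R J q) p" using pp Jc \<open>u \<in> J\<close> by auto
  qed
qed

lemma frob_power_Suc:
  "ideal J R \<Longrightarrow> frob_power R J (p ^ Suc e) = frob_power R (frob_power R J (p ^ e)) p"
  by (simp add: frob_power_frob_power mult.commute)

lemma frob_power_add:
  "ideal J R \<Longrightarrow> frob_power R (frob_power R J (p ^ d)) (p ^ e) = frob_power R J (p ^ (d + e))"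
proof (induction e)
  case 0
  show ?case using frob_power_1[OF frob_power_ideal[OF ideal_subset[OF 0]]] by simp
next
  case (Suc e)
  have i: "ideal (frob_power R J (p ^ d)) R" using frob_power_ideal ideal_subset Suc.prems by blast
  show ?case using Suc frob_power_Suc[OF i, of e] frob_power_Suc[OF Suc.prems, of "d + e"] by simp
qed

lemma funpow_root_ideal: "ideal K R \<Longrightarrow> ideal ((root ^^ e) K) R"
  by (induction e) (auto simp: root_ideal ideal_subset)

text \<open>Each outer \<open>root\<close> is traded for one Frobenius power of \<open>J\<close> by
  \<open>root_subset_iff\<close>, and these powers compose.\<close>

lemma funpow_root_subset_iff:
  "ideal K R \<Longrightarrow> ideal J R \<Longrightarrow> (root ^^ e) K \<subseteq> J \<longleftrightarrow> K \<subseteq> frob_power R J (p ^ e)"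
proof (induction e arbitrary: J)
  case 0
  then show ?case using frob_power_1 by simp
next
  case (Suc e)
  have i: "ideal (frob_power R J p) R" using frob_power_ideal ideal_subset Suc.prems by blast
  have "(root ^^ Suc e) K \<subseteq> J \<longleftrightarrow> (root ^^ e) K \<subseteq> frob_power R J p"
    using root_subset_iff[OF ideal_subset[OF funpow_root_ideal]] Suc.prems by simp
  also have "\<dots> \<longleftrightarrow> K \<subseteq> frob_power R J (p ^ Suc e)"
    using Suc.IH[OF Suc.prems(1) i] frob_power_add[OF Suc.prems(2), of 1 e] by simp
  finally show ?case .
qed

text \<open>The equivalence \<open>funpow_root_subset_iff\<close> says exactly that the iterate is
  the least ideal in the definite description.\<close>

lemma frob_root_eq:
  assumes "ideal K R"
  shows "frob_root R K (p ^ e) = (root ^^ e) K"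
  unfolding frob_root_def
proof (rule the_equality)
  show "ideal ((root ^^ e) K) R \<and> K \<subseteq> frob_power R ((root ^^ e) K) (p ^ e) \<and>
    (\<forall>J'. ideal J' R \<and> K \<subseteq> frob_power R J' (p ^ e) \<longrightarrow> (root ^^ e) K \<subseteq> J')"
    using funpow_root_ideal[OF assms] funpow_root_subset_iff[OF assms] by blast
  then show "J = (root ^^ e) K"
    if "ideal J R \<and> K \<subseteq> frob_power R J (p ^ e) \<and>
      (\<forall>J'. ideal J' R \<and> K \<subseteq> frob_power R J' (p ^ e) \<longrightarrow> J \<subseteq> J')" for J
    using that by (intro subset_antisym) auto
qed

text \<open>Flatness of Frobenius: \<open>(C\<^sup>[\<^sup>q\<^sup>] : x\<^sup>q) = (C : x)\<^sup>[\<^sup>q\<^sup>]\<close>.\<close>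

lemma frob_power_colon:
  assumes "ideal C R" "x \<in> carrier R" "y \<in> carrier R" "x [^] (p ^ k) \<otimes> y \<in> frob_power R C (p ^ k)"
  shows "y \<in> frob_power R (colon_ideal R C x) (p ^ k)"
  using assms(3,4)
proof (induction k arbitrary: y)
  case 0
  then show ?case
    using frob_power_1[OF assms(1)] frob_power_1[OF colon_ideal_ideal[OF assms(1,2)]] assms(2)
    by (simp add: colon_ideal_def)
next
  case (Suc k)
  let ?C = "frob_power R C (p ^ k)" and ?x = "x [^] (p ^ k)"
  have iC: "ideal ?C R" using frob_power_ideal ideal_subset assms(1) by blast
  have ic: "ideal (colon_ideal R C x) R" using colon_ideal_ideal assms by blast
  have xc: "?x \<in> carrier R" using assms(2) by simp
  have ic2: "ideal (colon_ideal R ?C ?x) R" using colon_ideal_ideal iC xc by blast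
  have "?x [^] p \<otimes> y \<in> frob_power R ?C p"
    using Suc.prems(2) frob_power_Suc[OF assms(1)] assms(2) by (simp add: nat_pow_pow mult.commute)
  \<comment> \<open>Passing to coordinates strips one Frobenius from both the ideal and the factor
    \<open>?x [^] p\<close>, so the induction hypothesis applies to each
    \<open>coord y b\<close>.\<close>
  then have "\<forall>b\<in>B. ?x \<otimes> coord y b \<in> ?C"
    unfolding frob_power_iff[OF iC] using coord_pow_mult[OF xc Suc.prems(1)] by simp
  then have "\<forall>b\<in>B. coord y b \<in> frob_power R (colon_ideal R C x) (p ^ k)"
    using Suc.IH Suc.prems(1) by simp
  then show ?case
    unfolding frob_power_Suc[OF ic] using Suc.prems(1)
    by (subst frob_power_iff[OF frob_power_ideal[OF ideal_subset[OF ic]]]) auto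
qed

text \<open>This is \<open>frob_power_colon\<close> for \<open>y = \<one>\<close>: the Frobenius
  power of \<open>(C : x)\<close> contains \<open>\<one>\<close>, hence so does
  \<open>(C : x)\<close>.\<close>

lemma frob_power_cancel:
  assumes "ideal C R" "x \<in> carrier R" "x [^] (p ^ k) \<in> frob_power R C (p ^ k)"
  shows "x \<in> C"
proof -
  have "\<one> \<in> frob_power R (colon_ideal R C x) (p ^ k)"
    using frob_power_colon[OF assms(1,2) one_closed] assms(2,3) by simp
  then have "\<one> \<in> colon_ideal R C x"
    using frob_power_subset[OF colon_ideal_ideal[OF assms(1,2)], of "p ^ k"] p_pos by auto
  then show ?thesis using assms(2) by (simp add: colon_ideal_def)
qed

end

section \<open>Comparison of ideals and powers of sums of ideals\<close>

lemma (in cring) PIdl_subset_iff: "f \<in> carrier R \<Longrightarrow> ideal K R \<Longrightarrow> PIdl f \<subseteq> K \<longleftrightarrow> f \<in> K"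
  using cgenideal_self cgenideal_minimal by blast

text \<open>Roots are known only through the ideals containing them, so they are identified in this
  way.\<close>

lemma ideal_eqI:
  assumes "ideal K R" "ideal L R" "\<And>J. ideal J R \<Longrightarrow> K \<subseteq> J \<longleftrightarrow> L \<subseteq> J"
  shows "K = L"
  using assms by blast

lemma (in cring) ideal_pow_PIdl:
  assumes "f \<in> carrier R"
  shows "ideal_pow R (PIdl f) n = PIdl (f [^] n)"
proof (induction n)
  case 0
  show ?case using cgenideal_eq_genideal[OF one_closed] genideal_one by simp
next
  case (Suc n)
  have i: "ideal (PIdl (f [^] n)) R" "ideal (PIdl f) R" "ideal (PIdl (f [^] n \<otimes> f)) R"
    using assms by (auto intro: cgenideal_ideal)
  have "(PIdl (f [^] n)) \<cdot> (PIdl f) = Idl (PIdl (f [^] n \<otimes> f))"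
    using ideal_prod_eq_genideal[OF i(1,2)] cgenideal_prod[of "f [^] n" f] assms by simp
  also have "\<dots> = PIdl (f [^] n \<otimes> f)"
    using genideal_minimal[OF i(3) order_refl] genideal_self[OF ideal_subset[OF i(3)]] by blast
  finally show ?case using Suc by simp
qed

lemma ideal_prod_mono: "I \<subseteq> I' \<Longrightarrow> J \<subseteq> J' \<Longrightarrow> I \<cdot>\<^bsub>R\<^esub> J \<subseteq> I' \<cdot>\<^bsub>R\<^esub> J'"
proof
  fix x assume "I \<subseteq> I'" "J \<subseteq> J'" "x \<in> I \<cdot>\<^bsub>R\<^esub> J"
  from this(3,1,2) show "x \<in> I' \<cdot>\<^bsub>R\<^esub> J'"
    by (induction rule: ideal_prod.induct) (auto intro: ideal_prod.intros)
qed

lemma (in cring) ideal_pow_antimono: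
  assumes "ideal K R" "n \<le> m"
  shows "ideal_pow R K m \<subseteq> ideal_pow R K n"
  using assms(2)
proof (induction rule: dec_induct)
  case (step i)
  have "ideal_pow R K (Suc i) \<subseteq> ideal_pow R K i"
    using ideal_prod_inter[OF ideal_pow_ideal[OF assms(1)] assms(1), of i] by simp
  then show ?case using step.IH by blast
qed simp

text \<open>Pigeonhole principle: among \<open>i + j\<close> factors from \<open>A <+> C\<close>, at
  least \<open>i\<close> come from \<open>A\<close> or at least \<open>j\<close> from
  \<open>C\<close>. In the induction the last factor lowers \<open>i\<close> or \<open>j\<close>; if
  either is 0, the right-hand side is the whole ring.\<close>

lemma (in cring) ideal_pow_add_subset:
  assumes A: "ideal A R" and C: "ideal C R"
  shows "ideal_pow R (A <+> C) (i + j) \<subseteq> ideal_pow R A i <+> ideal_pow R C j"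
proof (induction "i + j" arbitrary: i j)
  case 0
  then show ?case
    using le_add_ideals(1)[OF oneideal oneideal] by simp
next
  case (Suc n)
  note iA = ideal_pow_ideal[OF A] and iC = ideal_pow_ideal[OF C]
  have AC: "ideal (A <+> C) R" using add_ideals A C by blast
  note iAC = ideal_pow_ideal[OF AC]
  show ?case
  proof (cases "i = 0 \<or> j = 0")
    case True
    then have "carrier R \<subseteq> ideal_pow R A i <+> ideal_pow R C j"
      using le_add_ideals[OF iA[of i] iC[of j]] by auto
    then show ?thesis using ideal_subset[OF iAC] by blast
  next
    case False
    then obtain i' j' where ij: "i = Suc i'" "j = Suc j'" by (meson not0_implies_Suc)
    then have n: "n = i' + j" "n = i + j'" using Suc(2) by auto
    let ?T = "ideal_pow R A i <+> ideal_pow R C j"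
    have iT: "ideal ?T R" using add_ideals iA iC by blast
    note le = le_add_ideals[OF iA[of i] iC[of j]]
    have "ideal_pow R (A <+> C) n \<cdot> A \<subseteq> ?T"
    proof -
      have "ideal_pow R (A <+> C) n \<cdot> A \<subseteq> (ideal_pow R A i' <+> ideal_pow R C j) \<cdot> A"
        using Suc(1)[OF n(1)] n(1) by (intro ideal_prod_mono) auto
      also have "\<dots> = ideal_pow R A i' \<cdot> A <+> ideal_pow R C j \<cdot> A"
        by (rule ideal_prod_distr(2)[OF A iA iC])
      also have "\<dots> \<subseteq> ?T"
      proof (rule add_ideals_le[OF iT])
        show "ideal_pow R A i' \<cdot> A \<subseteq> ?T" using le(1) ij(1) by simp
        show "ideal_pow R C j \<cdot> A \<subseteq> ?T" using ideal_prod_inter[OF iC A, of j] le(2) by blast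
      qed
      finally show ?thesis .
    qed
    moreover have "ideal_pow R (A <+> C) n \<cdot> C \<subseteq> ?T"
    proof -
      have "ideal_pow R (A <+> C) n \<cdot> C \<subseteq> (ideal_pow R A i <+> ideal_pow R C j') \<cdot> C"
        using Suc(1)[OF n(2)] n(2) by (intro ideal_prod_mono) auto
      also have "\<dots> = ideal_pow R A i \<cdot> C <+> ideal_pow R C j' \<cdot> C"
        by (rule ideal_prod_distr(2)[OF C iA iC])
      also have "\<dots> \<subseteq> ?T"
      proof (rule add_ideals_le[OF iT])
        show "ideal_pow R C j' \<cdot> C \<subseteq> ?T" using le(2) ij(2) by simp
        show "ideal_pow R A i \<cdot> C \<subseteq> ?T" using ideal_prod_inter[OF iA C, of i] le(1) by blast
      qed
      finally show ?thesis .
    qed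
    ultimately have "ideal_pow R (A <+> C) n \<cdot> A <+> ideal_pow R (A <+> C) n \<cdot> C \<subseteq> ?T"
      by (rule add_ideals_le[OF iT])
    moreover have "ideal_pow R (A <+> C) (Suc n) = ideal_pow R (A <+> C) n \<cdot> A <+> ideal_pow R (A <+> C) n \<cdot> C"
      using ideal_prod_distr(1)[OF iAC A C, of n] by simp
    ultimately show ?thesis using Suc(2) by (simp del: nat_pow_Suc)
  qed
qed

text \<open>Pigeonhole principle again: among this many factors some generator occurs at least
  \<open>m\<close> times. Generators are split off one at a time, each taking \<open>m\<close> from
  the exponent.\<close>

lemma (in cring) ideal_pow_Idl_subset:
  assumes "ideal K R" "finite H" "H \<subseteq> carrier R" "\<And>h. h \<in> H \<Longrightarrow> h [^] (m::nat) \<in> K"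
  shows "ideal_pow R (Idl H) (card H * m + 1) \<subseteq> K"
  using assms(2-)
proof (induction H)
  case empty
  \<comment> \<open>Without generators the exponent is 1, so the power is zero; the exponent 0 would
    give the unit ideal.\<close>
  have "carrier R \<cdot> {\<zero>} = {\<zero>}" by (rule ideal_prod_zero[OF oneideal])
  then show ?case
    using additive_subgroup.zero_closed[OF ideal.axioms(1)[OF assms(1)]] by (simp add: Idl_empty)
next
  case (insert h H)
  then have c: "H \<subseteq> carrier R" "h \<in> carrier R" by auto
  have "ideal_pow R (Idl (insert h H)) (card (insert h H) * m + 1)
      = ideal_pow R (Idl H <+> PIdl h) ((card H * m + 1) + m)"
    using insert(1,2) Idl_insert[OF c] by (simp add: add_ac del: nat_pow_Suc)
  also have "\<dots> \<subseteq> ideal_pow R (Idl H) (card H * m + 1) <+> ideal_pow R (PIdl h) m"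
    by (rule ideal_pow_add_subset[OF genideal_ideal[OF c(1)] cgenideal_ideal[OF c(2)]])
  also have "\<dots> \<subseteq> K"
    using insert cgenideal_minimal[OF assms(1)] c
    by (intro add_ideals_le[OF assms(1)]) (auto simp: ideal_pow_PIdl)
  finally show ?case .
qed

text \<open>An element \<open>y\<close> outside \<open>M\<close> is invertible modulo
  \<open>M\<close>, say \<open>\<one> = m \<oplus> r \<otimes> y\<close>. Some power of
  \<open>m\<close> lies in \<open>K\<close> and is still congruent to \<open>\<one>\<close> modulo
  \<open>y\<close>, so \<open>y\<close> is invertible modulo \<open>K\<close> and can be
  cancelled.\<close>

lemma (in cring) primary_to_maximalidealI:
  assumes M: "maximalideal M R" and K: "ideal K R" "K \<subseteq> M"
    and pow: "\<And>x. x \<in> M \<Longrightarrow> \<exists>n::nat. x [^] n \<in> K"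
  shows "primary_to R M K"
proof -
  interpret M: maximalideal M R by fact
  interpret Mp: primeideal M R by (rule maximalideal_prime[OF M])
  interpret K: ideal K R by fact
  have "ideal_radical R K = M"
    using pow K(2) Mp.pow_mem M.Icarr unfolding ideal_radical_def by blast
  moreover have "primary_ideal R K"
    unfolding primary_ideal_def
  proof (intro conjI ballI impI K(1))
    show "K \<noteq> carrier R" using K(2) M.I_notcarr M.a_subset by blast
    fix x y assume x: "x \<in> carrier R" and y: "y \<in> carrier R" and xy: "x \<otimes> y \<in> K"
    show "x \<in> K \<or> (\<exists>n::nat. y [^] n \<in> K)"
    proof (cases "y \<in> M")
      case False
      have i: "ideal (M <+> PIdl y) R" using add_ideals M.is_ideal cgenideal_ideal[OF y] by blast
      have "M <+> PIdl y = carrier R"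
      proof -
        have "y \<in> M <+> PIdl y"
          using le_add_ideals(2)[OF M.is_ideal cgenideal_ideal[OF y]] cgenideal_self[OF y] by blast
        then show ?thesis
          using M.I_maximal[OF i] le_add_ideals(1)[OF M.is_ideal cgenideal_ideal[OF y]]
            ideal_subset[OF i] False by blast
      qed
      then have "\<one> \<in> M <+> PIdl y" by simp
      then obtain m r where m: "m \<in> M" "r \<in> carrier R" "\<one> = m \<oplus> r \<otimes> y"
        by (auto simp: mem_add_PIdl)
      have mc: "m \<in> carrier R" using M.Icarr m(1) by auto
      obtain n :: nat where n: "m [^] n \<in> K" using pow[OF m(1)] by blast
      have "\<exists>s\<in>carrier R. m [^] k = \<one> \<oplus> s \<otimes> y" for k :: nat
      proof (induction k)
        case 0
        show ?case by (rule bexI[of _ \<zero>]) (use y in auto)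
      next
        case (Suc k)
        then obtain s where s: "s \<in> carrier R" "m [^] k = \<one> \<oplus> s \<otimes> y" by blast
        have m1: "m = \<one> \<ominus> r \<otimes> y"
          using m mc y by (simp add: a_minus_def a_assoc r_neg)
        have "m [^] Suc k = m \<oplus> (s \<otimes> m) \<otimes> y"
          using s(1) mc y by (simp add: s(2) l_distr r_distr m_ac)
        also have "\<dots> = (\<one> \<ominus> r \<otimes> y) \<oplus> (s \<otimes> m) \<otimes> y"
          using m1 by (rule arg_cong[where f = "\<lambda>t. t \<oplus> (s \<otimes> m) \<otimes> y"])
        also have "\<dots> = \<one> \<oplus> (s \<otimes> m \<ominus> r) \<otimes> y"
          using s(1) mc m(2) y by (simp add: a_minus_def l_distr l_minus a_ac)
        finally have "m [^] Suc k = \<one> \<oplus> (s \<otimes> m \<ominus> r) \<otimes> y" .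
        then show ?case using s mc m(2) by (metis m_closed minus_closed)
      qed
      then obtain s where s: "s \<in> carrier R" "m [^] n = \<one> \<oplus> s \<otimes> y" by blast
      have "x \<otimes> m [^] n = x \<oplus> s \<otimes> (x \<otimes> y)"
        unfolding s(2) using s(1) x y by (simp add: r_distr m_ac)
      then have "x = x \<otimes> m [^] n \<ominus> s \<otimes> (x \<otimes> y)"
        using s(1) x y by (simp add: a_minus_def a_assoc r_neg)
      moreover have "x \<otimes> m [^] n \<ominus> s \<otimes> (x \<otimes> y) \<in> K"
        unfolding a_minus_def
        using K.I_l_closed[OF n x] K.I_l_closed[OF xy s(1)] by simp
      ultimately show ?thesis by simp
    qed (use pow in auto)
  qed
  ultimately show ?thesis unfolding primary_to_def by simp
qed

context frobenius_free
begin

lemma frob_add_pow: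
  "x \<in> carrier R \<Longrightarrow> y \<in> carrier R \<Longrightarrow> (x \<oplus> y) [^] (p ^ e) = x [^] (p ^ e) \<oplus> y [^] (p ^ e)"
proof (induction e)
  case (Suc e)
  have "z [^] (p ^ Suc e) = (z [^] (p ^ e)) [^] p" if "z \<in> carrier R" for z
    using that by (simp add: nat_pow_pow mult.commute)
  then show ?case using Suc by (simp add: frob_add del: power_Suc)
qed simp

text \<open>The \<open>q\<close>-th power map is additive for \<open>q = p ^ e\<close>, so the
  elements whose \<open>q\<close>-th power lies in a given ideal form an ideal, and generators
  suffice.\<close>

lemma frob_power_Idl:
  assumes "G \<subseteq> carrier R"
  shows "frob_power R (Idl G) (p ^ e) = Idl ((\<lambda>z. z [^] (p ^ e)) ` G)"
proof
  let ?H = "(\<lambda>z. z [^] (p ^ e)) ` G"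
  have Hc: "?H \<subseteq> carrier R" using assms by auto
  have iG: "ideal (Idl G) R" and iH: "ideal (Idl ?H) R"
    using assms Hc by (auto intro: genideal_ideal)
  interpret H: ideal "Idl ?H" R by (rule iH)
  have "0 < p ^ e" using p_pos by simp
  then have "ideal {y \<in> carrier R. y [^] (p ^ e) \<in> Idl ?H} R"
    by (intro ideal_criterion) (auto simp: frob_add_pow nat_pow_distrib H.I_l_closed nat_pow_zero)
  moreover have "G \<subseteq> {y \<in> carrier R. y [^] (p ^ e) \<in> Idl ?H}"
    using assms genideal_self[OF Hc] by auto
  ultimately have "Idl G \<subseteq> {y \<in> carrier R. y [^] (p ^ e) \<in> Idl ?H}" by (rule genideal_minimal)
  then show "frob_power R (Idl G) (p ^ e) \<subseteq> Idl ?H"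
    by (subst frob_power_subset_iff[OF iH ideal_subset[OF iG]]) auto
  show "Idl ?H \<subseteq> frob_power R (Idl G) (p ^ e)"
    using pow_mem_frob_power[OF ideal_subset[OF iG]] genideal_self[OF assms]
    by (intro genideal_minimal frob_power_ideal ideal_subset iG) auto
qed

section \<open>Every ideal is an iterated root of a principal ideal\<close>

lemma pow_basis_mem_frob_power_iff:
  assumes "ideal J R" "x \<in> carrier R" "u \<in> B"
  shows "x [^] p \<otimes> u \<in> frob_power R J p \<longleftrightarrow> x \<in> J"
proof -
  have "\<zero> \<in> J" using additive_subgroup.zero_closed[OF ideal.axioms(1)[OF assms(1)]] .
  then show ?thesis
    using assms basis_carrier by (auto simp: frob_power_iff[OF assms(1)] coord_basis)
qed

lemma exists_root_principal_of_rank_ge_2: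
  assumes u: "u \<in> B" "v \<in> B" "u \<noteq> v"
  shows "finite F \<Longrightarrow> F \<subseteq> carrier R \<Longrightarrow> \<exists>f\<in>carrier R. \<exists>e. (root ^^ e) (PIdl f) = Idl F"
proof (induction "card F" arbitrary: F rule: less_induct)
  case less
  have uc: "u \<in> carrier R" "v \<in> carrier R" using u basis_carrier by auto
  consider "F = {}" | z where "F = {z}" | y z F' where "F = insert y (insert z F')" "y \<notin> insert z F'" "z \<notin> F'"
    by (metis insertCI mk_disjoint_insert all_not_in_conv)
  then show ?case
  proof cases
    case 1
    have "(root ^^ 0) (PIdl \<zero>) = Idl F"
      using 1 cgenideal_eq_genideal[OF zero_closed] by (simp add: Idl_empty genideal_zero)
    then show ?thesis using zero_closed by blast
  next
    case 2
    then have zc: "z \<in> carrier R" using less.prems by simp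
    then have "(root ^^ 0) (PIdl z) = Idl F" using 2 cgenideal_eq_genideal by simp
    then show ?thesis using zc by blast
  next
    case 3
    have c: "y \<in> carrier R" "z \<in> carrier R" "F' \<subseteq> carrier R" using 3 less.prems by auto
    \<comment> \<open>Its coordinates are \<open>y\<close> at \<open>u\<close>, \<open>z\<close> at
      \<open>v\<close> and zero elsewhere, so \<open>?g\<close> lies in \<open>J^[p]\<close> exactly
      when \<open>y\<close> and \<open>z\<close> lie in \<open>J\<close>. The new family has fewer
      elements than \<open>F\<close>, and one more \<open>root\<close> recovers
      \<open>Idl F\<close>.\<close>
    let ?g = "y [^] p \<otimes> u \<oplus> z [^] p \<otimes> v"
    let ?F = "insert ?g ((\<lambda>w. w [^] p \<otimes> u) ` F')"
    have fin: "finite F'" using 3 less.prems by simp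
    have Fc: "?F \<subseteq> carrier R" using c uc by auto
    have "card ?F \<le> Suc (card F')"
      using fin by (intro order_trans[OF card_insert_le_m1]) (auto simp: card_image_le)
    also have "\<dots> < card F" using 3 fin by simp
    finally obtain f e where f: "f \<in> carrier R" "(root ^^ e) (PIdl f) = Idl ?F"
      using less.hyps[of ?F] fin Fc by auto
    have "root (Idl ?F) = Idl F"
    proof (rule ideal_eqI)
      have iF: "ideal (Idl ?F) R" by (rule genideal_ideal[OF Fc])
      show "ideal (root (Idl ?F)) R" by (rule root_ideal[OF ideal_subset[OF iF]])
      show "ideal (Idl F) R" by (rule genideal_ideal[OF less.prems(2)])
      fix J assume J: "ideal J R"
      interpret J: ideal J R by fact
      have iJ: "ideal (frob_power R J p) R" by (rule frob_power_ideal[OF ideal_subset[OF J]])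
      have "?g \<in> frob_power R J p \<longleftrightarrow> y \<in> J \<and> z \<in> J"
        using c uc u by (auto simp: frob_power_iff[OF J] coord_add coord_basis)
      moreover have "w [^] p \<otimes> u \<in> frob_power R J p \<longleftrightarrow> w \<in> J" if "w \<in> F'" for w
        using pow_basis_mem_frob_power_iff[OF J _ u(1)] that c(3) by auto
      ultimately have "?F \<subseteq> frob_power R J p \<longleftrightarrow> F \<subseteq> J" using 3 by auto
      then show "root (Idl ?F) \<subseteq> J \<longleftrightarrow> Idl F \<subseteq> J"
        using root_subset_iff[OF ideal_subset[OF iF] J] Idl_subset_ideal[OF iJ Fc]
          Idl_subset_ideal[OF J less.prems(2)] by simp
    qed
    then have "(root ^^ Suc e) (PIdl f) = Idl F" using f(2) by simp
    then show ?thesis using f(1) by blast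
  qed
qed

section \<open>The case of at most one basis element: perfect Noetherian rings\<close>

lemma perfect_of_rank_le_1:
  assumes "\<And>u v. u \<in> B \<Longrightarrow> v \<in> B \<Longrightarrow> u = v" "x \<in> carrier R"
  shows "\<exists>y\<in>carrier R. y [^] p = x"
proof (cases "B = {}")
  case True
  then have "x = \<zero>" using coord_comb[OF assms(2)] by simp
  then show ?thesis using zero_pow_p zero_closed by blast
next
  case False
  then obtain u where B: "B = {u}" using assms(1) by blast
  then have uc: "u \<in> carrier R" using basis_carrier by simp
  have cf: "z = coord z u [^] p \<otimes> u" "coord z u \<in> carrier R" if "z \<in> carrier R" for z
  proof -
    show cz: "coord z u \<in> carrier R" using coord_closed[OF that] B by simp
    have "z = comb (coord z)" using coord_comb[OF that] by simp
    also have "\<dots> = coord z u [^] p \<otimes> u" using cz uc by (simp add: B)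
    finally show "z = coord z u [^] p \<otimes> u" .
  qed
  let ?e = "coord \<one> u" and ?y = "coord (x \<otimes> u) u"
  have c: "?e \<in> carrier R" "?y \<in> carrier R" using cf(2) assms(2) uc by auto
  \<comment> \<open>The single coordinate gives \<open>\<one> = ?e [^] p \<otimes> u\<close> and
    \<open>x \<otimes> u = ?y [^] p \<otimes> u\<close>; multiplying the latter by
    \<open>?e [^] p\<close> cancels \<open>u\<close>.\<close>
  have "x = x \<otimes> (?e [^] p \<otimes> u)" using cf(1)[OF one_closed] assms(2) by simp
  also have "\<dots> = ?e [^] p \<otimes> (x \<otimes> u)" using c uc assms(2) by (simp add: m_ac)
  also have "x \<otimes> u = ?y [^] p \<otimes> u" using cf(1)[of "x \<otimes> u"] assms(2) uc by simp
  also have "?e [^] p \<otimes> (?y [^] p \<otimes> u) = ?y [^] p \<otimes> (?e [^] p \<otimes> u)"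
    using c uc by (simp add: m_ac)
  also have "\<dots> = ?y [^] p" using cf(1)[OF one_closed] c by simp
  finally have "x = ?y [^] p" .
  then show ?thesis using c(2) by metis
qed

text \<open>A Noetherian perfect ring is von Neumann regular: the ideals \<open>(x\<^sup>1\<^sup>/\<^sup>q)\<close> ascend.\<close>

lemma perfect_von_neumann_regular:
  assumes perfect: "\<And>x. x \<in> carrier R \<Longrightarrow> \<exists>y\<in>carrier R. y [^] p = x" and x: "x \<in> carrier R"
  shows "\<exists>a\<in>carrier R. x = a \<otimes> (x \<otimes> x)"
proof -
  obtain g where g: "\<And>x. x \<in> carrier R \<Longrightarrow> g x \<in> carrier R \<and> g x [^] p = x"
    using perfect by metis
  have c: "(g ^^ n) x \<in> carrier R" for n by (induction n) (use x g in auto)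
  have pow: "(g ^^ n) x [^] (p ^ n) = x" for n
  proof (induction n)
    case (Suc n)
    have "(g ^^ Suc n) x [^] (p ^ Suc n) = (g ((g ^^ n) x) [^] p) [^] (p ^ n)"
      using nat_pow_pow[of "g ((g ^^ n) x)" p "p ^ n"] g[OF c] by (simp del: power_Suc add: power_Suc)
    also have "\<dots> = x" using Suc g[OF c] by simp
    finally show ?case .
  qed (use x in simp)
  obtain n where n: "\<And>m. PIdl ((g ^^ n) x) \<subseteq> PIdl ((g ^^ m) x) \<Longrightarrow> PIdl ((g ^^ m) x) = PIdl ((g ^^ n) x)"
  proof (rule exists_maximal_ideal_in[of "\<lambda>K. \<exists>n. K = PIdl ((g ^^ n) x)" "PIdl x"])
    show "\<exists>n. PIdl x = PIdl ((g ^^ n) x)" by (rule exI[of _ 0]) simp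
    show "ideal K R" if "\<exists>n. K = PIdl ((g ^^ n) x)" for K using that c cgenideal_ideal by blast
    fix K assume K: "\<exists>n. K = PIdl ((g ^^ n) x)"
      and max: "\<And>L. \<exists>n. L = PIdl ((g ^^ n) x) \<Longrightarrow> K \<subseteq> L \<Longrightarrow> L = K"
    obtain n where "K = PIdl ((g ^^ n) x)" using K by blast
    then show thesis using max by (intro that[of n]) blast
  qed
  \<comment> \<open>Here \<open>?w [^] p\<close> is the preceding root, which generates the same
    ideal by the choice of \<open>n\<close>. So \<open>?w = a \<otimes> ?w [^] p\<close>, and
    raising this to the power \<open>p ^ Suc n\<close> makes \<open>x\<close> a multiple of
    \<open>x [^] p\<close>, hence of \<open>x \<otimes> x\<close>.\<close>
  let ?w = "(g ^^ Suc n) x"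
  have wc: "?w \<in> carrier R" by (rule c)
  have wp: "?w [^] p = (g ^^ n) x" using g c by simp
  have "?w [^] p \<in> PIdl ?w"
    using pow_mem_ideal[OF cgenideal_ideal[OF wc] cgenideal_self[OF wc] p_pos] .
  then have "PIdl ((g ^^ n) x) \<subseteq> PIdl ?w"
    using cgenideal_minimal[OF cgenideal_ideal[OF wc]] wp by simp
  then have "?w \<in> PIdl ((g ^^ n) x)" using n[of "Suc n"] cgenideal_self[OF wc] by blast
  then obtain a where a: "a \<in> carrier R" "?w = a \<otimes> ?w [^] p"
    using wp unfolding cgenideal_def by auto
  let ?q = "p ^ Suc n"
  have "x = (a \<otimes> ?w [^] p) [^] ?q" using pow[of "Suc n"] a(2) by simp
  also have "\<dots> = a [^] ?q \<otimes> (?w [^] ?q) [^] p"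
    using a(1) wc by (simp add: nat_pow_distrib nat_pow_pow mult.commute del: funpow.simps power_Suc)
  also have "\<dots> = a [^] ?q \<otimes> x [^] p" using pow[of "Suc n"] by simp
  also have "x [^] p = x [^] (p - 2) \<otimes> (x \<otimes> x)"
  proof -
    have "p = (p - 2) + 2" using prime_ge_2_nat[OF prime_p] by simp
    then have "x [^] p = x [^] (p - 2) \<otimes> x [^] (2::nat)" using x by (metis nat_pow_mult)
    then show ?thesis using x by (simp add: numeral_2_eq_2)
  qed
  finally have "x = (a [^] ?q \<otimes> x [^] (p - 2)) \<otimes> (x \<otimes> x)"
    using a(1) x by (simp add: m_assoc)
  then show ?thesis using a(1) x by (intro bexI[of _ "a [^] ?q \<otimes> x [^] (p - 2)"]) auto
qed

text \<open>Choose \<open>f\<close> in \<open>K\<close> with \<open>PIdl f\<close> maximal. By von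
  Neumann regularity \<open>f = \<epsilon> \<otimes> f\<close> with
  \<open>\<epsilon> = a \<otimes> f\<close> idempotent. Each \<open>y\<close> in \<open>K\<close> is
  absorbed by enlarging \<open>f\<close> with the part of \<open>y\<close> complementary to
  \<open>\<epsilon>\<close>.\<close>

lemma perfect_principal:
  assumes perfect: "\<And>x. x \<in> carrier R \<Longrightarrow> \<exists>y\<in>carrier R. y [^] p = x" and K: "ideal K R"
  shows "\<exists>f\<in>carrier R. PIdl f = K"
proof -
  interpret K: ideal K R by fact
  obtain f where f: "f \<in> K" "\<And>g. g \<in> K \<Longrightarrow> PIdl f \<subseteq> PIdl g \<Longrightarrow> PIdl g = PIdl f"
  proof (rule exists_maximal_ideal_in[of "\<lambda>L. \<exists>f\<in>K. L = PIdl f" "PIdl \<zero>"])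
    show "\<exists>f\<in>K. PIdl \<zero> = PIdl f" using K.zero_closed by blast
    show "ideal L R" if "\<exists>f\<in>K. L = PIdl f" for L using that K.Icarr cgenideal_ideal by blast
    fix L assume L: "\<exists>f\<in>K. L = PIdl f"
      and max: "\<And>L'. \<exists>f\<in>K. L' = PIdl f \<Longrightarrow> L \<subseteq> L' \<Longrightarrow> L' = L"
    obtain f where "f \<in> K" "L = PIdl f" using L by blast
    then show thesis using max by (intro that[of f]) blast+
  qed
  have fc: "f \<in> carrier R" using K.Icarr f(1) .
  obtain a where a: "a \<in> carrier R" "f = a \<otimes> (f \<otimes> f)"
    using perfect_von_neumann_regular[OF perfect fc] by blast
  have "K \<subseteq> PIdl f"
  proof
    fix y assume y: "y \<in> K"
    then have yc: "y \<in> carrier R" using K.Icarr by auto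
    let ?\<epsilon> = "a \<otimes> f"
    \<comment> \<open>Multiplication by \<open>?\<epsilon>\<close> recovers \<open>f\<close> from
      \<open>?g\<close>, so \<open>PIdl f \<subseteq> PIdl ?g\<close> and maximality puts
      \<open>?g\<close> into \<open>PIdl f\<close>. Then \<open>y\<close> is there too, since
      \<open>?\<epsilon> \<otimes> y\<close> is a multiple of \<open>f\<close>.\<close>
    let ?g = "f \<oplus> (y \<ominus> ?\<epsilon> \<otimes> y)"
    have ec: "?\<epsilon> \<in> carrier R" and gc: "?g \<in> carrier R" using a fc yc by auto
    have ef: "?\<epsilon> \<otimes> f = f" using a fc by (simp add: m_assoc)
    have ee: "?\<epsilon> \<otimes> (?\<epsilon> \<otimes> y) = ?\<epsilon> \<otimes> y"
    proof -
      have "?\<epsilon> \<otimes> (?\<epsilon> \<otimes> y) = a \<otimes> (?\<epsilon> \<otimes> f) \<otimes> y" using a(1) fc yc by (simp add: m_ac)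
      then show ?thesis by (simp only: ef)
    qed
    have "?\<epsilon> \<otimes> ?g = ?\<epsilon> \<otimes> f \<oplus> (?\<epsilon> \<otimes> y \<ominus> ?\<epsilon> \<otimes> (?\<epsilon> \<otimes> y))"
      using ec fc yc by (simp add: r_distr a_minus_def r_minus)
    also have "\<dots> = f" using ec fc yc by (simp only: ef ee) (simp add: a_minus_def r_neg)
    finally have eg: "?\<epsilon> \<otimes> ?g = f" .
    then have "f \<in> PIdl ?g" using ec unfolding cgenideal_def by force
    then have "PIdl f \<subseteq> PIdl ?g" by (rule cgenideal_minimal[OF cgenideal_ideal[OF gc]])
    moreover have "?g \<in> K"
      using f(1) y K.I_l_closed[OF y ec] unfolding a_minus_def by simp
    ultimately have "?g \<in> PIdl f" using f(2)[of ?g] cgenideal_self[OF gc] by simp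
    then obtain r where r: "r \<in> carrier R" "?g = r \<otimes> f" unfolding cgenideal_def by auto
    have "y = ?g \<ominus> f \<oplus> (a \<otimes> y) \<otimes> f"
    proof -
      have "(a \<otimes> y) \<otimes> f = ?\<epsilon> \<otimes> y" using a(1) fc yc by (simp add: m_ac)
      moreover have "?g \<ominus> f \<oplus> ?\<epsilon> \<otimes> y = (f \<oplus> \<ominus> f) \<oplus> (y \<oplus> (\<ominus> (?\<epsilon> \<otimes> y) \<oplus> ?\<epsilon> \<otimes> y))"
        using ec fc yc by (simp add: a_minus_def a_ac)
      ultimately show ?thesis using ec fc yc by (simp add: r_neg l_neg)
    qed
    also have "\<dots> = (r \<ominus> \<one> \<oplus> a \<otimes> y) \<otimes> f"
      unfolding r(2) using r(1) a(1) fc yc by (simp add: a_minus_def l_distr l_minus)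
    finally show "y \<in> PIdl f" using r(1) a(1) yc unfolding cgenideal_def by blast
  qed
  then show ?thesis using cgenideal_minimal[OF K f(1)] fc by blast
qed

lemma exists_root_principal:
  assumes K: "ideal K R"
  shows "\<exists>f\<in>carrier R. \<exists>e. (root ^^ e) (PIdl f) = K"
proof (cases "\<exists>u\<in>B. \<exists>v\<in>B. u \<noteq> v")
  case True
  obtain F where "F \<subseteq> carrier R" "finite F" "K = Idl F" using finetely_gen[OF K] by blast
  then show ?thesis using True exists_root_principal_of_rank_ge_2 by blast
next
  case False
  then have "\<exists>y\<in>carrier R. y [^] p = x" if "x \<in> carrier R" for x
    using perfect_of_rank_le_1 that by blast
  then obtain f where "f \<in> carrier R" "(root ^^ 0) (PIdl f) = K"
    using perfect_principal[OF _ K] by auto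
  then show ?thesis by blast
qed

end

context frobenius_free
begin

section \<open>Test ideals\<close>

text \<open>For an exponent with denominator \<open>p ^ d\<close> the ceiling is exact at every
  level \<open>e = d + j\<close>, where it equals \<open>n * p ^ j\<close>; the lower levels do not
  affect the stable value.\<close>

lemma test_ideal_eqI:
  assumes K: "ideal K R"
    and eq: "\<And>j. (root ^^ (d + j)) (ideal_pow R K (n * p ^ j)) = I"
  shows "test_ideal R p K (real n / real (p ^ d)) = I"
  unfolding test_ideal_def
proof (rule the_equality)
  let ?X = "\<lambda>e. frob_root R (ideal_pow R K (nat \<lceil>real n / real (p ^ d) * real (p ^ e)\<rceil>)) (p ^ e)"
  have "?X e = I" if "d \<le> e" for e
  proof -
    obtain j where j: "e = d + j" using le_Suc_ex[OF \<open>d \<le> e\<close>] by (elim exE)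
    have "real n / real (p ^ d) * real (p ^ e) = real (n * p ^ j)"
      using p_pos by (simp add: j power_add)
    then have "nat \<lceil>real n / real (p ^ d) * real (p ^ e)\<rceil> = n * p ^ j" by (simp only: ceiling_of_nat nat_int)
    then show ?thesis using frob_root_eq[OF ideal_pow_ideal[OF K]] eq j by simp
  qed
  then show ev: "\<forall>\<^sub>F e in sequentially. ?X e = I" unfolding eventually_sequentially by blast
  fix J assume "\<forall>\<^sub>F e in sequentially. ?X e = J"
  with ev have "\<forall>\<^sub>F e in sequentially. J = I" by eventually_elim simp
  then show "J = I" by simp
qed

text \<open>Both sides are contained in the same ideals: by \<open>frob_power_cancel\<close>, common
  Frobenius powers of an element and of an ideal can be removed.\<close>

lemma funpow_root_pow:
  assumes f: "f \<in> carrier R"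
  shows "(root ^^ (e + j)) (PIdl (f [^] (p ^ j))) = (root ^^ e) (PIdl f)"
proof (rule ideal_eqI)
  let ?g = "f [^] (p ^ j)"
  have g: "?g \<in> carrier R" using f by simp
  show "ideal ((root ^^ (e + j)) (PIdl ?g)) R" "ideal ((root ^^ e) (PIdl f)) R"
    using funpow_root_ideal cgenideal_ideal f g by blast+
  fix J assume J: "ideal J R"
  have iJ: "ideal (frob_power R J (p ^ d)) R" for d using frob_power_ideal[OF ideal_subset[OF J]] .
  have "?g \<in> frob_power R J (p ^ (e + j)) \<longleftrightarrow> f \<in> frob_power R J (p ^ e)"
    using frob_power_cancel[OF iJ f] pow_mem_frob_power[OF ideal_subset[OF iJ], of f e "p ^ j"]
      frob_power_add[OF J, of e j] by auto
  then show "(root ^^ (e + j)) (PIdl ?g) \<subseteq> J \<longleftrightarrow> (root ^^ e) (PIdl f) \<subseteq> J"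
    using funpow_root_subset_iff[OF cgenideal_ideal J] PIdl_subset_iff[OF _ iJ] f g by simp
qed

theorem exists_principal_test_ideal:
  assumes "ideal I R"
  shows "\<exists>f\<in>carrier R. \<exists>c::real. c > 0 \<and> I = test_ideal R p (PIdl f) c"
proof -
  obtain f e where f: "f \<in> carrier R" "(root ^^ e) (PIdl f) = I"
    using exists_root_principal[OF assms] by blast
  have "test_ideal R p (PIdl f) (real 1 / real (p ^ e)) = I"
    by (rule test_ideal_eqI[OF cgenideal_ideal[OF f(1)]])
      (use f funpow_root_pow[OF f(1)] in \<open>simp add: ideal_pow_PIdl\<close>)
  moreover have "real 1 / real (p ^ e) > 0" using p_pos by simp
  ultimately show ?thesis using f(1) by metis
qed

section \<open>Primary ideals as test ideals\<close>

lemma funpow_root_mono_exponent: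
  assumes "ideal K R"
  shows "(root ^^ k) K \<subseteq> (root ^^ Suc k) K"
proof -
  let ?J = "(root ^^ Suc k) K"
  have J: "ideal ?J R" by (rule funpow_root_ideal[OF assms])
  have iJ: "ideal (frob_power R ?J (p ^ k)) R" by (rule frob_power_ideal[OF ideal_subset[OF J]])
  have "K \<subseteq> frob_power R ?J (p ^ Suc k)"
    using funpow_root_subset_iff[OF assms J, of "Suc k"] by blast
  also have "\<dots> = frob_power R (frob_power R ?J (p ^ k)) p" by (rule frob_power_Suc[OF J])
  also have "\<dots> \<subseteq> frob_power R ?J (p ^ k)" by (rule frob_power_subset[OF iJ p_pos])
  finally show ?thesis using funpow_root_subset_iff[OF assms J] by blast
qed

text \<open>The stable value \<open>E\<close> of the roots of \<open>(f\<^sup>r)\<close> satisfies \<open>E = E\<^sup>2\<close>; the idempotent generating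
  \<open>E\<close> acts as the identity on \<open>f\<close>.\<close>

lemma stable_root_acts:
  assumes f: "f \<in> carrier R"
  shows "\<exists>k. \<exists>a\<in>(root ^^ k) (PIdl (f [^] Suc r)). f = f \<otimes> a"
proof -
  let ?K = "PIdl (f [^] Suc r)"
  have fr: "f [^] Suc r \<in> carrier R" using f by simp
  have K: "ideal ?K R" by (rule cgenideal_ideal[OF fr])
  obtain k where k: "\<And>m. (root ^^ k) ?K \<subseteq> (root ^^ m) ?K \<Longrightarrow> (root ^^ m) ?K = (root ^^ k) ?K"
  proof (rule exists_maximal_ideal_in[of "\<lambda>L. \<exists>k. L = (root ^^ k) ?K" ?K])
    show "\<exists>k. ?K = (root ^^ k) ?K" by (rule exI[of _ 0]) simp
    show "ideal L R" if "\<exists>k. L = (root ^^ k) ?K" for L using that funpow_root_ideal[OF K] by blast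
    fix L assume L: "\<exists>k. L = (root ^^ k) ?K"
      and max: "\<And>L'. \<exists>k. L' = (root ^^ k) ?K \<Longrightarrow> L \<subseteq> L' \<Longrightarrow> L' = L"
    obtain k where "L = (root ^^ k) ?K" using L by blast
    then show thesis using max by (intro that[of k]) blast
  qed
  define E where "E = (root ^^ k) ?K"
  have E: "ideal E R" unfolding E_def by (rule funpow_root_ideal[OF K])
  interpret E: ideal E R by (rule E)
  have "(root ^^ Suc k) ?K = (root ^^ k) ?K" by (rule k[OF funpow_root_mono_exponent[OF K]])
  then have "root E = E" unfolding E_def by simp
  then have EF: "E \<subseteq> frob_power R E p"
    using root_subset_iff[OF E.a_subset E] by simp
  have EE: "ideal (E \<cdot> E) R" by (rule ideal_prod_is_ideal[OF E E])
  \<comment> \<open>Since \<open>p \<ge> 2\<close>, a \<open>p\<close>-th power splits into two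
    factors from \<open>E\<close>. Together with \<open>E \<subseteq> E^[p]\<close> this gives
    \<open>E \<subseteq> E \<cdot> E\<close>.\<close>
  have "u [^] p \<in> E \<cdot> E" if u: "u \<in> E" for u
  proof -
    have p2: "p = Suc (p - 1)" "0 < p - 1" using prime_ge_2_nat[OF prime_p] by auto
    have "u [^] (p - 1) \<otimes> u \<in> E \<cdot> E"
      using pow_mem_ideal[OF E u p2(2)] u by (rule ideal_prod.prod)
    then show ?thesis using p2(1) by (metis nat_pow_Suc)
  qed
  then have "E \<subseteq> E \<cdot> E"
    using EF frob_power_subset_iff[OF EE E.a_subset, of p] by blast
  then have tE: "\<one> \<otimes> x \<in> {\<zero>} <+> E \<cdot> E" if "x \<in> E" for x
    using that le_add_ideals(2)[OF zeroideal EE] E.Icarr by auto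
  obtain F where F: "F \<subseteq> carrier R" "finite F" "E = Idl F" using finetely_gen[OF E] by blast
  have FE: "F \<subseteq> E" using genideal_self[OF F(1)] F(3) by simp
  have "E \<subseteq> {\<zero>} <+> Idl F" using le_add_ideals(2)[OF zeroideal E] unfolding F(3)[symmetric] .
  \<comment> \<open>With \<open>t = \<one>\<close> and \<open>J = {\<zero>}\<close> the determinant
    trick makes \<open>\<one> \<oplus> a\<close> annihilate \<open>E\<close>, so
    \<open>\<ominus> a\<close> acts on \<open>E\<close> as the identity.\<close>
  then obtain n a where a: "a \<in> E" "\<forall>x\<in>E. (\<one> [^] (n::nat) \<oplus> a) \<otimes> x \<in> {\<zero>}"
    using determinant_trick[OF E E one_closed F(2) FE zeroideal _ tE] by blast
  have ac: "a \<in> carrier R" using a(1) E.Icarr by auto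
  have "?K \<subseteq> frob_power R E (p ^ k)"
    using funpow_root_subset_iff[OF K E] unfolding E_def by blast
  also have "\<dots> \<subseteq> E" using p_pos by (intro frob_power_subset[OF E]) simp
  finally have "f [^] Suc r \<in> E" using cgenideal_self[OF fr] by blast
  then have u: "(\<one> \<oplus> a) \<otimes> f [^] Suc r = \<zero>" using a(2) by simp
  \<comment> \<open>A power of \<open>f\<close> lies in \<open>E\<close>, so
    \<open>(\<one> \<oplus> a) \<otimes> f\<close> is nilpotent and therefore zero. Thus
    \<open>\<ominus> a\<close> fixes \<open>f\<close> itself.\<close>
  have "((\<one> \<oplus> a) \<otimes> f) [^] Suc r = (\<one> \<oplus> a) [^] r \<otimes> ((\<one> \<oplus> a) \<otimes> f [^] Suc r)"
    using ac f by (simp add: nat_pow_distrib m_ac)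
  also have "\<dots> = \<zero>" using ac by (simp only: u) simp
  finally have "((\<one> \<oplus> a) \<otimes> f) [^] Suc r = \<zero>" .
  then have "(\<one> \<oplus> a) \<otimes> f = \<zero>"
    by (rule nilpotent_eq_zero[OF reduced, rotated 3]) (use ac f in auto)
  then have "f \<oplus> a \<otimes> f = \<zero>" using ac f by (simp add: l_distr)
  then have "\<ominus> (a \<otimes> f) = f" by (rule minus_equality) (use ac f in auto)
  then have "f = f \<otimes> (\<ominus> a)" using ac f by (simp add: r_minus m_comm)
  moreover have "\<ominus> a \<in> E" using a(1) by simp
  ultimately show ?thesis unfolding E_def by blast
qed

theorem exists_primary_test_ideal:
  assumes M: "maximalideal M R" and MI: "primary_to R M I"
  shows "\<exists>K. \<exists>c::real. primary_to R M K \<and> c > 0 \<and> I = test_ideal R p K c"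
proof -
  have I: "ideal I R" and rad: "ideal_radical R I = M"
    using MI unfolding primary_to_def primary_ideal_def by auto
  interpret I: ideal I R by (rule I)
  have IM: "I \<subseteq> M"
  proof
    fix x assume "x \<in> I"
    then have "x \<in> carrier R" "x [^] (1::nat) \<in> I" using I.Icarr by auto
    then show "x \<in> M" unfolding rad[symmetric] ideal_radical_def by blast
  qed
  obtain f d where f: "f \<in> carrier R" "(root ^^ d) (PIdl f) = I"
    using exists_root_principal[OF I] by blast
  have if': "ideal (PIdl f) R" by (rule cgenideal_ideal[OF f(1)])
  have fI: "f \<in> frob_power R I (p ^ d)"
    using funpow_root_subset_iff[OF if' I, of d] f PIdl_subset_iff[OF f(1) frob_power_ideal[OF I.a_subset]]
    by simp
  obtain G where G: "G \<subseteq> carrier R" "finite G" "I = Idl G" using finetely_gen[OF I] by blast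
  \<comment> \<open>One more than the number of generators, so that \<open>?r * p ^ j\<close>
    reaches the pigeonhole bound \<open>card ?H * p ^ j + 1\<close> at every level
    \<open>j\<close>.\<close>
  let ?r = "Suc (card G)"
  obtain k a where a: "a \<in> (root ^^ k) (PIdl (f [^] ?r))" "f = f \<otimes> a"
    using stable_root_acts[OF f(1), of "card G"] by blast
  \<comment> \<open>The exponent \<open>?n / p ^ ?e\<close> exceeds \<open>1 / p ^ d\<close> by
    \<open>?r / p ^ ?e\<close>; the relation \<open>f = f \<otimes> a\<close> will show that the
    test ideal still contains \<open>I\<close>.\<close>
  let ?e = "d + k" and ?n = "p ^ k + ?r"
  let ?H = "(\<lambda>z. z [^] (p ^ ?e)) ` G"
  have Hc: "?H \<subseteq> carrier R" using G(1) by auto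
  have H: "frob_power R I (p ^ ?e) = Idl ?H" unfolding G(3) by (rule frob_power_Idl[OF G(1)])
  \<comment> \<open>The summand \<open>Idl ?H\<close> is \<open>I^[p ^ ?e]\<close>. It contains a
    power of every element of \<open>M\<close>, which makes \<open>K\<close> primary to
    \<open>M\<close>.\<close>
  define K where "K = PIdl f <+> Idl ?H"
  have iH: "ideal (Idl ?H) R" by (rule genideal_ideal[OF Hc])
  have K: "ideal K R" unfolding K_def by (rule add_ideals[OF if' iH])
  have fK: "f \<in> K" unfolding K_def using le_add_ideals(1)[OF if' iH] cgenideal_self[OF f(1)] by blast
  have "primary_to R M K"
  proof (rule primary_to_maximalidealI[OF M K])
    interpret M: maximalideal M R by (rule M)
    have "0 < p ^ d" "0 < p ^ ?e" using p_pos by auto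
    then have "f \<in> M" "Idl ?H \<subseteq> M"
      using frob_power_subset[OF I] fI IM H by blast+
    then show "K \<subseteq> M"
      unfolding K_def using cgenideal_minimal[OF M.is_ideal] by (intro add_ideals_le[OF M.is_ideal])
    fix x assume "x \<in> M"
    then obtain m :: nat where x: "x \<in> carrier R" "x [^] m \<in> I"
      unfolding rad[symmetric] ideal_radical_def by blast
    have "(x [^] m) [^] (p ^ ?e) \<in> K"
      using pow_mem_frob_power[OF I.a_subset x(2)] le_add_ideals(2)[OF if' iH] H
      unfolding K_def by blast
    then show "\<exists>n::nat. x [^] n \<in> K" using nat_pow_pow[OF x(1)] by metis
  qed
  moreover have "test_ideal R p K (real ?n / real (p ^ ?e)) = I"
  proof (rule test_ideal_eqI[OF K], rule subset_antisym)
    fix j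
    let ?X = "frob_power R I (p ^ (?e + j))"
    have X: "ideal ?X R" by (rule frob_power_ideal[OF I.a_subset])
    let ?N = "?n * p ^ j"
    have iN: "ideal (ideal_pow R K ?N) R" by (rule ideal_pow_ideal[OF K])
    \<comment> \<open>The exponent is split so that both parts land in \<open>?X\<close>:
      \<open>p ^ (k + j)\<close> copies of \<open>f\<close>, since \<open>f\<close> lies in
      \<open>I^[p ^ d]\<close>, or \<open>?r * p ^ j\<close> factors from
      \<open>Idl ?H\<close>.\<close>
    have "ideal_pow R K ?N = ideal_pow R (PIdl f <+> Idl ?H) (p ^ (k + j) + ?r * p ^ j)"
      unfolding K_def by (simp add: power_add algebra_simps del: nat_pow_Suc)
    also have "\<dots> \<subseteq> ideal_pow R (PIdl f) (p ^ (k + j)) <+> ideal_pow R (Idl ?H) (?r * p ^ j)"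
      by (rule ideal_pow_add_subset[OF if' iH])
    also have "\<dots> \<subseteq> ?X"
    proof (rule add_ideals_le[OF X])
      have "f [^] (p ^ (k + j)) \<in> ?X"
        using pow_mem_frob_power[OF ideal_subset[OF frob_power_ideal[OF I.a_subset]] fI, of "p ^ (k + j)"]
          frob_power_add[OF I, of d "k + j"] by (simp add: add.assoc)
      then show "ideal_pow R (PIdl f) (p ^ (k + j)) \<subseteq> ?X"
        using ideal_pow_PIdl[OF f(1)] cgenideal_minimal[OF X] by simp
      have "h [^] (p ^ j) \<in> ?X" if "h \<in> ?H" for h
      proof -
        obtain z where z: "z \<in> G" "h = z [^] (p ^ ?e)" using \<open>h \<in> ?H\<close> by blast
        have "z \<in> I" using z(1) genideal_self[OF G(1)] G(3) by blast
        then show ?thesis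
          using pow_mem_frob_power[OF I.a_subset] nat_pow_pow[of z "p ^ ?e" "p ^ j"] I.Icarr z(2)
          by (simp add: power_add)
      qed
      then have "ideal_pow R (Idl ?H) (card ?H * p ^ j + 1) \<subseteq> ?X"
        using G(2) by (intro ideal_pow_Idl_subset[OF X _ Hc]) auto
      moreover have "card ?H * p ^ j + 1 \<le> ?r * p ^ j"
      proof -
        have "card ?H * p ^ j \<le> card G * p ^ j" using card_image_le[OF G(2)] by (intro mult_le_mono1)
        moreover have "1 \<le> p ^ j" using p_pos by simp
        ultimately have "card ?H * p ^ j + 1 \<le> card G * p ^ j + p ^ j" by (rule add_mono)
        then show ?thesis by (simp only: mult_Suc add.commute)
      qed
      ultimately show "ideal_pow R (Idl ?H) (?r * p ^ j) \<subseteq> ?X"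
        using ideal_pow_antimono[OF iH] by blast
    qed
    finally show "(root ^^ (?e + j)) (ideal_pow R K ?N) \<subseteq> I"
      using funpow_root_subset_iff[OF iN I] by blast
    define J where "J = (root ^^ (?e + j)) (ideal_pow R K ?N)"
    have J: "ideal J R" unfolding J_def by (rule funpow_root_ideal[OF iN])
    have iF: "ideal (frob_power R J (p ^ i)) R" for i by (rule frob_power_ideal[OF ideal_subset[OF J]])
    let ?C = "frob_power R J (p ^ d)"
    \<comment> \<open>For the reverse inclusion the power of \<open>f\<close> alone suffices.
      Cancelling \<open>p ^ j\<close> leaves \<open>f [^] (p ^ k) \<otimes> f [^] ?r\<close> in the
      \<open>p ^ k\<close>-th Frobenius power of \<open>?C\<close>, and flatness moves the first
      factor into a colon ideal.\<close>
    have "f [^] ?N \<in> frob_power R J (p ^ (?e + j))"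
      using pow_mem_ideal_pow[OF K fK, of ?N] funpow_root_subset_iff[OF iN J] unfolding J_def by blast
    then have "(f [^] ?n) [^] (p ^ j) \<in> frob_power R (frob_power R J (p ^ ?e)) (p ^ j)"
      using frob_power_add[OF J, of ?e j] nat_pow_pow[OF f(1), of ?n "p ^ j"] by simp
    then have "f [^] ?n \<in> frob_power R J (p ^ ?e)"
      using frob_power_cancel[OF iF] f(1) nat_pow_closed by blast
    then have "f [^] (p ^ k) \<otimes> f [^] ?r \<in> frob_power R ?C (p ^ k)"
      using frob_power_add[OF J, of d k] nat_pow_mult[OF f(1), of "p ^ k" ?r] by (simp del: nat_pow_Suc)
    then have fr: "f [^] ?r \<in> frob_power R (colon_ideal R ?C f) (p ^ k)"
      using frob_power_colon[OF iF f(1)] f(1) nat_pow_closed by blast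
    have ic: "ideal (colon_ideal R ?C f) R" by (rule colon_ideal_ideal[OF iF f(1)])
    have fc: "f [^] ?r \<in> carrier R" by (rule nat_pow_closed[OF f(1)])
    have "PIdl (f [^] ?r) \<subseteq> frob_power R (colon_ideal R ?C f) (p ^ k)"
      using PIdl_subset_iff[OF fc frob_power_ideal[OF ideal_subset[OF ic]]] fr by blast
    \<comment> \<open>This root contains \<open>a\<close>, so \<open>f = f \<otimes> a\<close> lies
      in \<open>?C\<close>; applying the \<open>d\<close>-th root gives
      \<open>I \<subseteq> J\<close>.\<close>
    then have "(root ^^ k) (PIdl (f [^] ?r)) \<subseteq> colon_ideal R ?C f"
      using funpow_root_subset_iff[OF cgenideal_ideal[OF fc] ic] by blast
    then have "f \<otimes> a \<in> ?C" using a(1) unfolding colon_ideal_def by blast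
    then have "f \<in> ?C" using a(2) by simp
    then show "I \<subseteq> (root ^^ (?e + j)) (ideal_pow R K ?N)"
      using funpow_root_subset_iff[OF if' J, of d] PIdl_subset_iff[OF f(1) iF] f(2)
      unfolding J_def[symmetric] by blast
  qed
  moreover have "real ?n / real (p ^ ?e) > 0"
    using p_pos by (intro divide_pos_pos) (simp_all del: of_nat_add of_nat_power)
  ultimately show ?thesis by metis
qed

end

lemma (in regular_ring) frobenius_free_basis:
  assumes p: "Factorial_Ring.prime p" "contains_prime_field R p"
    and "finite_free_over R (power_subring R p)"
  shows "\<exists>B. frobenius_free R p B"
proof -
  obtain B where B: "B \<subseteq> carrier R" "finite B"
    "\<forall>x\<in>carrier R. \<exists>!c. c \<in> B \<rightarrow>\<^sub>E power_subring R p \<and> x = (\<Oplus>b\<in>B. c b \<otimes> b)"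
    using assms(3) unfolding finite_free_over_def by blast
  have "frobenius_free R p B"
  proof (intro frobenius_free.intro frobenius_free_axioms.intro noetherian_cring.intro)
    show "cring R" by (rule is_cring)
    show "noetherian_ring R" by (rule noetherian_ring_axioms)
    show "Factorial_Ring.prime p" by (rule p(1))
    show "add_pow R p x = \<zero>" if "x \<in> carrier R" for x
      by (rule char_contains_prime_field[OF p(2) that])
    show "x = \<zero>" if "x \<in> carrier R" "x \<otimes> x = \<zero>" for x by (rule regular_ring_reduced[OF that])
  qed (use B in auto)
  then show ?thesis ..
qed

theorem theorem3p1:
  fixes R :: "('a, 'b) ring_scheme" (structure) and p :: nat
  assumes "Factorial_Ring.prime p"
    and "regular_ring R"
    and "contains_prime_field R p"
    and "finite_free_over R (power_subring R p)"
  shows "(\<forall>I. ideal I R \<longrightarrow>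
            (\<exists>f \<in> carrier R. \<exists>c::real. c > 0 \<and> I = test_ideal R p (PIdl f) c)) \<and>
         (\<forall>\<mm> I. maximalideal \<mm> R \<and> primary_to R \<mm> I \<longrightarrow>
            (\<exists>\<bb>. \<exists>c'::real. primary_to R \<mm> \<bb> \<and> c' > 0 \<and> I = test_ideal R p \<bb> c'))"
proof -
  obtain B where "frobenius_free R p B"
    using regular_ring.frobenius_free_basis[OF assms(2,1,3,4)] by blast
  then interpret frobenius_free R p B .
  show ?thesis
    using exists_principal_test_ideal exists_primary_test_ideal by blast
qed

end
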